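(* Let $G$ be a locally compact Hausdorff topological group. If $G$ is a compactly generated abelian group, then for every $n\in\mathbb N$ we have $\Sigma^n_{\mathrm{top}}(G)=\operatorname{Hom}_{\mathbf{TopGr}}(G,\mathbb R)$.
   Context: $\mathbb N$ contains $0$. $\operatorname{Hom}_{\mathbf{TopGr}}(G,\mathbb R)$ is the set of characters on $G$, i.e. continuous homomorphisms $\chi\colon G\to\mathbb R$; $G_\chi:=\{g\in G\mid\chi(g)\ge0\}$. Compactly generated means generated as a group by a compact subset. For a set $S$, $\mathrm E S$ is the simplicial set with $n$-simplices $S^{n+1}$, the $i$-th face (degeneracy) map deleting (doubling) the $i$-th entry. $\mathcal C(G)$ is the poset of compact subsets of $G$ ordered by inclusion. For $C\in\mathcal C(G)$, $G_\chi\cdot\mathrm E C\subseteq \mathrm E G$ is the simplicial subset of all simplices $(gx_0,\dots,gx_k)$ with $g\in G_\chi$, $x_i\in C$. A filtration $(X_\alpha)_{\alpha\in A}$ of a connected simplicial set $X$ over a directed poset $A$ (simplicial subsets, increasing in $\alpha$, with union $X$) is essentially $n$-connected if for a vertex $x\in X$ (the choice is immaterial), every $k$ with $0\le k\le n$ and every $\alpha$ with $x\in X_\alpha$, there is $\beta\ge\alpha$ such that $\pi_k(X_\alpha,x)\to\pi_k(X_\beta,x)$ is trivial (homotopy groups are those of geometric realizations); essentially $(-1)$-connected is a vacuous condition. $\Sigma^n_{\mathrm{top}}(G)$ is the set of characters $\chi$ for which the filtration $(G_\chi\cdot \mathrm E C)_{C\in\mathcal C(G)}$ of $\mathrm E G$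 is essentially $(n-1)$-connected. *)

theory Defs
  imports "HOL-Analysis.Analysis" "HOL-Homology.Homology" "HOL-Computational_Algebra.Group_Closure"
begin

section \<open>Simplicial sets\<close>

text \<open>
  \<open>face X n i\<close> is the face map from \<open>n\<close>-simplices to \<open>(n - 1)\<close>-simplices (meaningful for
  \<open>n \<ge> 1\<close> and \<open>i \<le> n\<close>), and \<open>degen X n i\<close> is the degeneracy map from \<open>n\<close>-simplices to
  \<open>(n + 1)\<close>-simplices (for \<open>i \<le> n\<close>). A simplicial subset is a record with smaller sets of
  simplices and the same operators.
\<close>

record 'a sset =
  simplices :: "nat \<Rightarrow> 'a set"
  face :: "nat \<Rightarrow> nat \<Rightarrow> 'a \<Rightarrow> 'a"
  degen :: "nat \<Rightarrow> nat \<Rightarrow> 'a \<Rightarrow> 'a"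

locale simplicial_set =
  fixes X :: "'a sset"
  assumes face_in: "x \<in> simplices X (Suc n) \<Longrightarrow> i \<le> Suc n \<Longrightarrow> face X (Suc n) i x \<in> simplices X n"
    and degen_in: "x \<in> simplices X n \<Longrightarrow> i \<le> n \<Longrightarrow> degen X n i x \<in> simplices X (Suc n)"
    and face_face: "x \<in> simplices X (Suc (Suc n)) \<Longrightarrow> i < j \<Longrightarrow> j \<le> Suc (Suc n) \<Longrightarrow>
      face X (Suc n) i (face X (Suc (Suc n)) j x) =
      face X (Suc n) (j - 1) (face X (Suc (Suc n)) i x)"
    and degen_degen: "x \<in> simplices X n \<Longrightarrow> i \<le> j \<Longrightarrow> j \<le> n \<Longrightarrow>
      degen X (Suc n) i (degen X n j x) = degen X (Suc n) (Suc j) (degen X n i x)"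
    and face_degen_less: "x \<in> simplices X (Suc n) \<Longrightarrow> i < j \<Longrightarrow> j \<le> Suc n \<Longrightarrow>
      face X (Suc (Suc n)) i (degen X (Suc n) j x) = degen X n (j - 1) (face X (Suc n) i x)"
    and face_degen_same: "x \<in> simplices X n \<Longrightarrow> j \<le> n \<Longrightarrow> i = j \<or> i = Suc j \<Longrightarrow>
      face X (Suc n) i (degen X n j x) = x"
    and face_degen_greater: "x \<in> simplices X (Suc n) \<Longrightarrow> Suc j < i \<Longrightarrow> i \<le> Suc (Suc n) \<Longrightarrow>
      face X (Suc (Suc n)) i (degen X (Suc n) j x) = degen X n j (face X (Suc n) (i - 1) x)"

definition simplicial_subset :: "'a sset \<Rightarrow> 'a sset \<Rightarrow> bool" where
  "simplicial_subset Y X \<longleftrightarrow>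
     simplicial_set Y \<and> face Y = face X \<and> degen Y = degen X \<and>
     (\<forall>n. simplices Y n \<subseteq> simplices X n)"

text \<open>The simplicial set \<open>E S\<close>: an \<open>n\<close>-simplex is a list of length \<open>n + 1\<close> over \<open>S\<close>.\<close>

definition E_sset :: "'s set \<Rightarrow> 's list sset" where
  "E_sset S =
     \<lparr>simplices = (\<lambda>n. {xs. length xs = Suc n \<and> set xs \<subseteq> S}),
      face = (\<lambda>n i xs. take i xs @ drop (Suc i) xs),
      degen = (\<lambda>n i xs. take (Suc i) xs @ drop i xs)\<rparr>"


section \<open>Geometric realization\<close>

text \<open>
  The map of standard simplices dual to the \<open>i\<close>-th degeneracy; its counterpart for the
  \<open>i\<close>-th face is \<^const>\<open>simplical_face\<close>.
\<close>

definition simplicial_codegen :: "nat \<Rightarrow> (nat \<Rightarrow> real) \<Rightarrow> nat \<Rightarrow> real" where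
  "simplicial_codegen i t =
     (\<lambda>j. if j < i then t j else if j = i then t i + t (Suc i) else t (Suc j))"

definition cells :: "'a sset \<Rightarrow> (nat \<times> 'a \<times> (nat \<Rightarrow> real)) topology" where
  "cells X =
     sum_topology
       (\<lambda>n. prod_topology (discrete_topology (simplices X n))
                          (subtopology (powertop_real UNIV) (standard_simplex n)))
       UNIV"

inductive glue :: "'a sset \<Rightarrow> nat \<times> 'a \<times> (nat \<Rightarrow> real) \<Rightarrow> nat \<times> 'a \<times> (nat \<Rightarrow> real) \<Rightarrow> bool"
  for X where
  glue_face: "x \<in> simplices X (Suc n) \<Longrightarrow> i \<le> Suc n \<Longrightarrow> t \<in> standard_simplex n \<Longrightarrow>
    glue X (n, face X (Suc n) i x, t) (Suc n, x, simplical_face i t)"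
| glue_degen: "x \<in> simplices X n \<Longrightarrow> i \<le> n \<Longrightarrow> t \<in> standard_simplex (Suc n) \<Longrightarrow>
    glue X (Suc n, degen X n i x, t) (n, x, simplicial_codegen i t)"

definition glue_rel :: "'a sset \<Rightarrow> ((nat \<times> 'a \<times> (nat \<Rightarrow> real)) \<times> (nat \<times> 'a \<times> (nat \<Rightarrow> real))) set"
  where "glue_rel X = {(p, q). equivclp (glue X) p q}"

text \<open>The quotient topology on the set of equivalence classes.\<close>

definition realization :: "'a sset \<Rightarrow> (nat \<times> 'a \<times> (nat \<Rightarrow> real)) set topology" where
  "realization X =
     topology (\<lambda>U. U \<subseteq> topspace (cells X) // glue_rel X \<and>
                   openin (cells X) {p \<in> topspace (cells X). glue_rel X `` {p} \<in> U})"

definition vertex_point :: "'a sset \<Rightarrow> 'a \<Rightarrow> (nat \<times> 'a \<times> (nat \<Rightarrow> real)) set" where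
  "vertex_point X x = glue_rel X `` {(0, x, \<lambda>i. if i = 0 then 1 else 0)}"

text \<open>
  If \<open>Y\<close> is a simplicial subset of \<open>X\<close>, every gluing of \<open>Y\<close> is a gluing of \<open>X\<close>, so a class for
  \<open>Y\<close> lies in exactly one class for \<open>X\<close>, and the map \<open>|Y| \<rightarrow> |X|\<close> induced by the inclusion
  is the following (\<open>Y\<close> only enters through the domain).
\<close>

definition realization_incl ::
  "'a sset \<Rightarrow> (nat \<times> 'a \<times> (nat \<Rightarrow> real)) set \<Rightarrow> (nat \<times> 'a \<times> (nat \<Rightarrow> real)) set" where
  "realization_incl X c = glue_rel X `` c"

lemma istopology_realization:
  "istopology (\<lambda>U. U \<subseteq> topspace (cells X) // glue_rel X \<and>
     openin (cells X) {p \<in> topspace (cells X). glue_rel X `` {p} \<in> U})"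
  unfolding istopology_def
proof (intro conjI allI impI)
  fix S T
  assume "S \<subseteq> topspace (cells X) // glue_rel X \<and>
            openin (cells X) {p \<in> topspace (cells X). glue_rel X `` {p} \<in> S}"
    and "T \<subseteq> topspace (cells X) // glue_rel X \<and>
            openin (cells X) {p \<in> topspace (cells X). glue_rel X `` {p} \<in> T}"
  moreover have "{p \<in> topspace (cells X). glue_rel X `` {p} \<in> S \<inter> T} =
    {p \<in> topspace (cells X). glue_rel X `` {p} \<in> S} \<inter>
    {p \<in> topspace (cells X). glue_rel X `` {p} \<in> T}" by auto
  ultimately show "S \<inter> T \<subseteq> topspace (cells X) // glue_rel X"
    and "openin (cells X) {p \<in> topspace (cells X). glue_rel X `` {p} \<in> S \<inter> T}"
    by auto
next
  fix K
  assume K: "\<forall>U\<in>K. U \<subseteq> topspace (cells X) // glue_rel X \<and>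
            openin (cells X) {p \<in> topspace (cells X). glue_rel X `` {p} \<in> U}"
  then show "\<Union>K \<subseteq> topspace (cells X) // glue_rel X" by blast
  have "{p \<in> topspace (cells X). glue_rel X `` {p} \<in> \<Union>K} =
    (\<Union>U\<in>K. {p \<in> topspace (cells X). glue_rel X `` {p} \<in> U})" by auto
  with K show "openin (cells X) {p \<in> topspace (cells X). glue_rel X `` {p} \<in> \<Union>K}"
    by (metis (no_types, lifting) image_iff openin_Union)
qed

lemma openin_realization:
  "openin (realization X) U \<longleftrightarrow>
     U \<subseteq> topspace (cells X) // glue_rel X \<and>
     openin (cells X) {p \<in> topspace (cells X). glue_rel X `` {p} \<in> U}"
  unfolding realization_def by (simp add: istopology_realization topology_inverse')

lemma topspace_realization: "topspace (realization X) = topspace (cells X) // glue_rel X"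
proof
  show "topspace (realization X) \<subseteq> topspace (cells X) // glue_rel X"
    using openin_realization[of X "topspace (realization X)"] by simp
  have "{p \<in> topspace (cells X). glue_rel X `` {p} \<in> topspace (cells X) // glue_rel X} =
    topspace (cells X)" by (auto intro: quotientI)
  then have "openin (realization X) (topspace (cells X) // glue_rel X)"
    by (simp add: openin_realization)
  then show "topspace (cells X) // glue_rel X \<subseteq> topspace (realization X)"
    by (rule openin_subset)
qed

lemma quotient_map_realization:
  "quotient_map (cells X) (realization X) (\<lambda>p. glue_rel X `` {p})"
  unfolding quotient_map_def topspace_realization openin_realization
  by (auto simp: quotient_def)


section \<open>Homotopy groups\<close>

text \<open>
  Triviality of an induced map only refers to the underlying pointed set of \<open>\<pi>\<^sub>k\<close>, which is all
  that exists for \<open>k = 0\<close>, so the group structure for \<open>k \<ge> 1\<close> is not set up.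
\<close>

definition sphere_basepoint :: "nat \<Rightarrow> real" where
  "sphere_basepoint = (\<lambda>i. if i = 0 then 1 else 0)"

definition based_maps :: "nat \<Rightarrow> 'b topology \<Rightarrow> 'b \<Rightarrow> ((nat \<Rightarrow> real) \<Rightarrow> 'b) set" where
  "based_maps k X x = {f. continuous_map (nsphere k) X f \<and> f sphere_basepoint = x}"

definition based_homotopy_rel ::
  "nat \<Rightarrow> 'b topology \<Rightarrow> 'b \<Rightarrow> (((nat \<Rightarrow> real) \<Rightarrow> 'b) \<times> ((nat \<Rightarrow> real) \<Rightarrow> 'b)) set" where
  "based_homotopy_rel k X x =
     {(f, g). homotopic_with (\<lambda>h. h sphere_basepoint = x) (nsphere k) X f g}"

definition homotopy_group :: "nat \<Rightarrow> 'b topology \<Rightarrow> 'b \<Rightarrow> ((nat \<Rightarrow> real) \<Rightarrow> 'b) set set" where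
  "homotopy_group k X x = based_maps k X x // based_homotopy_rel k X x"

definition homotopy_group_trivial :: "nat \<Rightarrow> 'b topology \<Rightarrow> 'b \<Rightarrow> ((nat \<Rightarrow> real) \<Rightarrow> 'b) set" where
  "homotopy_group_trivial k X x = based_homotopy_rel k X x `` {\<lambda>_. x}"

definition homotopy_group_induced ::
  "nat \<Rightarrow> 'c topology \<Rightarrow> 'c \<Rightarrow> ('b \<Rightarrow> 'c) \<Rightarrow> ((nat \<Rightarrow> real) \<Rightarrow> 'b) set \<Rightarrow> ((nat \<Rightarrow> real) \<Rightarrow> 'c) set"
  where "homotopy_group_induced k Y y \<phi> c = based_homotopy_rel k Y y `` ((\<lambda>f. \<phi> \<circ> f) ` c)"


section \<open>Essential connectedness of filtrations\<close>

definition directed_poset :: "'i::order set \<Rightarrow> bool" where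
  "directed_poset A \<longleftrightarrow> A \<noteq> {} \<and> (\<forall>\<alpha>\<in>A. \<forall>\<beta>\<in>A. \<exists>\<gamma>\<in>A. \<alpha> \<le> \<gamma> \<and> \<beta> \<le> \<gamma>)"

definition filtration :: "'a sset \<Rightarrow> 'i::order set \<Rightarrow> ('i \<Rightarrow> 'a sset) \<Rightarrow> bool" where
  "filtration X A F \<longleftrightarrow>
     directed_poset A \<and>
     (\<forall>\<alpha>\<in>A. simplicial_subset (F \<alpha>) X) \<and>
     (\<forall>\<alpha>\<in>A. \<forall>\<beta>\<in>A. \<alpha> \<le> \<beta> \<longrightarrow> simplicial_subset (F \<alpha>) (F \<beta>)) \<and>
     (\<forall>n. simplices X n = (\<Union>\<alpha>\<in>A. simplices (F \<alpha>) n))"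

text \<open>
  To be used for filtrations \<open>F\<close> of a connected simplicial set \<open>X\<close> only. The condition does not
  depend on the choice of the vertex, and it is required here for all vertices. The integer \<open>n\<close>
  may be \<open>-1\<close>, in which case the condition is vacuous.
\<close>

definition essentially_connected ::
  "int \<Rightarrow> 'a sset \<Rightarrow> 'i::order set \<Rightarrow> ('i \<Rightarrow> 'a sset) \<Rightarrow> bool" where
  "essentially_connected n X A F \<longleftrightarrow>
     (\<forall>x \<in> simplices X 0. \<forall>k::nat. int k \<le> n \<longrightarrow>
       (\<forall>\<alpha>\<in>A. x \<in> simplices (F \<alpha>) 0 \<longrightarrow>
         (\<exists>\<beta>\<in>A. \<alpha> \<le> \<beta> \<and>
           (\<forall>c \<in> homotopy_group k (realization (F \<alpha>)) (vertex_point (F \<alpha>) x).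
              homotopy_group_induced k (realization (F \<beta>)) (vertex_point (F \<beta>) x)
                (realization_incl (F \<beta>)) c =
              homotopy_group_trivial k (realization (F \<beta>)) (vertex_point (F \<beta>) x)))))"


section \<open>The sets \<open>\<Sigma>\<^sup>n\<close>\<close>

text \<open>Groups are written additively; \<^class>\<open>topological_group_add\<close> does not assume commutativity.\<close>

definition Hom_TopGr :: "('g::topological_group_add \<Rightarrow> real) set" where
  "Hom_TopGr = {\<xi>. continuous_on UNIV \<xi> \<and> (\<forall>g h. \<xi> (g + h) = \<xi> g + \<xi> h)}"

definition halfspace :: "('g::topological_group_add \<Rightarrow> real) \<Rightarrow> 'g set" where
  "halfspace \<xi> = {g. 0 \<le> \<xi> g}"

definition translates_E :: "'g::topological_group_add set \<Rightarrow> 'g set \<Rightarrow> 'g list sset" where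
  "translates_E M C =
     (E_sset UNIV)\<lparr>simplices :=
        (\<lambda>n. {map (\<lambda>x. g + x) xs | g xs. g \<in> M \<and> xs \<in> simplices (E_sset C) n})\<rparr>"

definition Sigma_top :: "nat \<Rightarrow> ('g::topological_group_add \<Rightarrow> real) set" where
  "Sigma_top n =
     {\<xi> \<in> Hom_TopGr.
        essentially_connected (int n - 1) (E_sset UNIV) {C. compact C}
          (\<lambda>C. translates_E (halfspace \<xi>) C)}"


subsection \<open>The filtration is well-defined\<close>

lemma length_face_E: "i < length xs \<Longrightarrow> length (face (E_sset S) n i xs) = length xs - 1"
  by (simp add: E_sset_def)

lemma length_degen_E: "i < length xs \<Longrightarrow> length (degen (E_sset S) n i xs) = Suc (length xs)"
  by (auto simp: E_sset_def min_def)

lemma nth_face_E: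
  "i < length xs \<Longrightarrow> Suc k < length xs \<Longrightarrow>
     face (E_sset S) n i xs ! k = xs ! (if k < i then k else Suc k)"
  by (simp add: E_sset_def nth_append min_def)

lemma nth_degen_E:
  "i < length xs \<Longrightarrow> k < Suc (length xs) \<Longrightarrow>
     degen (E_sset S) n i xs ! k = xs ! (if k \<le> i then k else k - 1)"
  by (auto simp: E_sset_def nth_append min_def intro!: arg_cong[where f = "nth xs"])

lemma simplices_E: "xs \<in> simplices (E_sset S) n \<longleftrightarrow> length xs = Suc n \<and> set xs \<subseteq> S"
  by (simp add: E_sset_def)

lemma simplicial_set_E_sset: "simplicial_set (E_sset S)"
proof
  show "face (E_sset S) (Suc n) i x \<in> simplices (E_sset S) n"
    if "x \<in> simplices (E_sset S) (Suc n)" "i \<le> Suc n" for x n i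
    using that by (auto simp: E_sset_def dest: in_set_takeD in_set_dropD)
  show "degen (E_sset S) n i x \<in> simplices (E_sset S) (Suc n)"
    if "x \<in> simplices (E_sset S) n" "i \<le> n" for x n i
    using that by (auto simp: E_sset_def dest: in_set_takeD in_set_dropD)
qed (auto simp: simplices_E length_face_E length_degen_E nth_face_E nth_degen_E
          intro!: nth_equalityI)

lemma simplicial_set_translates_E: "simplicial_set (translates_E M C)"
proof -
  interpret E: simplicial_set "E_sset (UNIV :: 'a set)" by (rule simplicial_set_E_sset)
  interpret C: simplicial_set "E_sset C" by (rule simplicial_set_E_sset)
  have sub: "x \<in> simplices (E_sset UNIV) n" if "x \<in> simplices (translates_E M C) n" for x n
    using that by (auto simp: translates_E_def simplices_E)
  have face_map: "face (E_sset UNIV) n i (map f xs) = map f (face (E_sset C) n i xs)"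
    and degen_map: "degen (E_sset UNIV) n i (map f xs) = map f (degen (E_sset C) n i xs)"
    for n i and f :: "'a \<Rightarrow> 'a" and xs
    by (simp_all add: E_sset_def take_map drop_map)
  have [simp]: "face (translates_E M C) = face (E_sset UNIV)"
    "degen (translates_E M C) = degen (E_sset UNIV)"
    by (simp_all add: translates_E_def)
  show ?thesis
  proof
    show "face (translates_E M C) (Suc n) i x \<in> simplices (translates_E M C) n"
      if x: "x \<in> simplices (translates_E M C) (Suc n)" and i: "i \<le> Suc n" for x n i
    proof -
      obtain g xs where "x = map ((+) g) xs" "g \<in> M" "xs \<in> simplices (E_sset C) (Suc n)"
        using x by (auto simp: translates_E_def)
      with C.face_in[OF _ i] show ?thesis
        by (auto simp: face_map) (auto simp: translates_E_def)
    qed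
    show "degen (translates_E M C) n i x \<in> simplices (translates_E M C) (Suc n)"
      if x: "x \<in> simplices (translates_E M C) n" and i: "i \<le> n" for x n i
    proof -
      obtain g xs where "x = map ((+) g) xs" "g \<in> M" "xs \<in> simplices (E_sset C) n"
        using x by (auto simp: translates_E_def)
      with C.degen_in[OF _ i] show ?thesis
        by (auto simp: degen_map) (auto simp: translates_E_def)
    qed
  qed (auto dest!: sub simp: E.face_face E.degen_degen E.face_degen_less E.face_degen_same
         E.face_degen_greater)
qed

lemma filtration_translates_E:
  fixes \<xi> :: "'g::topological_group_add \<Rightarrow> real"
  assumes "\<xi> \<in> Hom_TopGr"
  shows "filtration (E_sset UNIV) {C. compact C} (\<lambda>C. translates_E (halfspace \<xi>) C)"
  unfolding filtration_def
proof (intro conjI)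
  have "compact ({} :: 'g set)" by simp
  then show "directed_poset {C :: 'g set. compact C}"
    unfolding directed_poset_def by (blast intro: compact_Un)
  show "\<forall>C\<in>{C. compact C}. simplicial_subset (translates_E (halfspace \<xi>) C) (E_sset UNIV)"
    by (auto simp: simplicial_subset_def simplicial_set_translates_E)
       (auto simp: translates_E_def simplices_E)
  show "\<forall>C\<in>{C. compact C}. \<forall>D\<in>{C. compact C}. C \<le> D \<longrightarrow>
          simplicial_subset (translates_E (halfspace \<xi>) C) (translates_E (halfspace \<xi>) D)"
    by (auto simp: simplicial_subset_def simplicial_set_translates_E)
       (fastforce simp: translates_E_def simplices_E)+
  have "\<xi> (0 + 0) = \<xi> 0 + \<xi> 0" using assms unfolding Hom_TopGr_def by blast
  then have 0: "0 \<in> halfspace \<xi>" by (simp add: halfspace_def)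
  show "\<forall>n. simplices (E_sset UNIV) n =
          (\<Union>C\<in>{C. compact C}. simplices (translates_E (halfspace \<xi>) C) n)"
  proof (intro allI equalityI subsetI)
    fix n and xs :: "'g list"
    assume "xs \<in> simplices (E_sset UNIV) n"
    moreover have "xs = map ((+) 0) xs" by (simp add: map_idI)
    ultimately have "xs \<in> simplices (translates_E (halfspace \<xi>) (set xs)) n"
      using 0 by (auto simp: translates_E_def simplices_E)
    then show "xs \<in> (\<Union>C\<in>{C. compact C}. simplices (translates_E (halfspace \<xi>) C) n)"
      using finite_imp_compact[of "set xs"] by blast
  qed (auto simp: translates_E_def simplices_E)
qed

end

theory Submission
  imports Defs
begin

text \<open>
  By Weil's lemma, a compactly generated locally compact abelian group \<open>G\<close> contains a discrete free
  subgroup of finite rank that is cocompact. Hence the elements of \<open>G\<close> have integer coordinates that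
  change by a bounded amount between neighbours, and shrinking all coordinates towards \<open>0\<close> by one per
  step moves translates of simplices of \<open>E C\<close> through translates of simplices of \<open>E D\<close>, for a
  compact \<open>D\<close> that does not depend on the number of steps. A compact subset of the realization
  involves only finitely many vertices, so finitely many steps bring these into a fixed compact set, after which they can be
  collapsed to one vertex. The shrinking may decrease the character by a bounded amount; to stay in
  the half-space, one first translates by a large multiple of an element \<open>t\<close> with \<open>\<chi> t > 0\<close>, which
  is homotopic to the identity through the translations by \<open>t\<close> because \<open>G\<close> is abelian. Thus every
  sphere in \<open>G\<^sub>\<chi> \<cdot> E C\<close> is null-homotopic in \<open>G\<^sub>\<chi> \<cdot> E D\<close>, in every dimension.
\<close>

section \<open>Integer multiples and sums of compact sets\<close>

text \<open>The order of quantifiers shapes the proof. One compact set \<open>D\<close> has to serve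
  all spheres in the realization for \<open>C\<close>, while the number of steps that a sphere needs
  is unbounded. Composing maps between members of the filtration would enlarge the target with every
  step. Therefore each intermediate map is defined on the whole group and is seen as a map from the
  same source, given by \<open>C\<close>, to the same target, given by \<open>D\<close>; only
  consecutive maps are compared. The bounds stay uniform because clipping an integer to [-i, i] is
  1-Lipschitz and raising i by one changes the result by at most one. The coordinates are mere
  choices, neither additive nor continuous. This does no harm: vertices form a discrete set in the
  realization, and a map of vertices is judged only by where it sends translates of
  \<open>C\<close>. A simplex of the filtration may have vertices of negative character; only the
  translating element \<open>g\<close> lies in the half-space. So the half-space condition concerns
  the image of \<open>g\<close>, not the images of the vertices.\<close>

lemma sum_const_add: "(\<Sum>i<a + b. g) = (\<Sum>i<a. g) + (\<Sum>i<b. g)" for g :: "'a::comm_monoid_add" and a b :: nat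
  by (induction b) (simp_all add: add.assoc)

definition zmul :: "int \<Rightarrow> 'a \<Rightarrow> 'a::ab_group_add" where
  "zmul k g = (\<Sum>i<nat k. g) - (\<Sum>i<nat (- k). g)"

text \<open>Writing integers as differences of naturals keeps sign distinctions in this one place;
  additivity then follows from that of the two sums.\<close>

lemma zmul_diff_nat: "zmul (int a - int b) g = (\<Sum>i<a. g) - (\<Sum>i<b. g)"
proof -
  show ?thesis
  proof (cases "b \<le> a")
    case True
    then have "zmul (int a - int b) g = (\<Sum>i<a - b. g)"
      by (simp add: zmul_def nat_diff_distrib flip: of_nat_diff)
    with True sum_const_add[of g "a - b" b] show ?thesis by simp
  next
    case False
    then have "zmul (int a - int b) g = - (\<Sum>i<b - a. g)"
      by (simp add: zmul_def flip: of_nat_diff)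
    with False sum_const_add[of g "b - a" a] show ?thesis by simp
  qed
qed

lemma zmul_add: "zmul (k + l) g = zmul k g + zmul l g"
proof -
  obtain a b where k: "k = int a - int b" by (cases k rule: int_diff_cases)
  obtain c d where l: "l = int c - int d" by (cases l rule: int_diff_cases)
  have "k + l = int (a + c) - int (b + d)" by (simp add: k l)
  then have "zmul (k + l) g = (\<Sum>i<a + c. g) - (\<Sum>i<b + d. g)"
    by (metis zmul_diff_nat)
  then show ?thesis
    unfolding k l zmul_diff_nat sum_const_add by (simp add: algebra_simps)
qed

lemma zmul_0 [simp]: "zmul 0 g = 0" and zmul_1 [simp]: "zmul 1 g = g"
  by (simp_all add: zmul_def)

lemma zmul_minus: "zmul (- k) g = - zmul k g"
  using zmul_add[of k "- k" g] by (simp add: eq_neg_iff_add_eq_0 add.commute)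

lemma zmul_diff: "zmul (k - l) g = zmul k g - zmul l g"
  using zmul_add[of k "- l" g] by (simp add: zmul_minus)

lemma zmul_hom:
  fixes \<xi> :: "'a::ab_group_add \<Rightarrow> real"
  assumes "\<And>g h. \<xi> (g + h) = \<xi> g + \<xi> h"
  shows "\<xi> (zmul k g) = of_int k * \<xi> g"
proof -
  have *: "\<xi> (zmul (int n) g) = real n * \<xi> g" for n
  proof (induction n)
    case 0
    then show ?case using assms[of 0 0] by simp
  next
    case (Suc n)
    then show ?case using assms by (simp add: zmul_add algebra_simps)
  qed
  show ?thesis
  proof (cases k rule: int_cases2)
    case (nonneg n)
    then show ?thesis using * by simp
  next
    case (nonpos n)
    then show ?thesis
      using *[of n] assms[of "zmul (- int n) g" "zmul (int n) g"] assms[of 0 0]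
      by (simp add: zmul_minus)
  qed
qed

lemma compact_set_plus:
  fixes A B :: "'a::topological_monoid_add set"
  assumes "compact A" "compact B"
  shows "compact (A + B)"
proof -
  have "A + B = (\<lambda>(a, b). a + b) ` (A \<times> B)"
    by (auto simp: set_plus_def)
  then show ?thesis
    using assms by (auto intro!: compact_continuous_image compact_Times continuous_intros
        simp: split_def)
qed

lemma compact_uminus_image:
  fixes A :: "'a::topological_group_add set"
  assumes "compact A"
  shows "compact (uminus ` A)"
  using assms by (intro compact_continuous_image continuous_intros)

text \<open>For finite \<open>F\<close> this is the subgroup generated by \<open>F\<close>. The
  coefficient functions are explicit because they later serve as coordinates.\<close>

definition int_span :: "'a set \<Rightarrow> 'a::ab_group_add set" where
  "int_span F = range (\<lambda>v. \<Sum>f\<in>F. zmul (v f) f)"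

lemma zero_in_int_span: "0 \<in> int_span F"
  unfolding int_span_def by (rule range_eqI[of _ _ "\<lambda>_. 0"]) simp

lemma int_span_add:
  assumes "a \<in> int_span F" "b \<in> int_span F"
  shows "a + b \<in> int_span F"
proof -
  obtain v w where "a = (\<Sum>f\<in>F. zmul (v f) f)" "b = (\<Sum>f\<in>F. zmul (w f) f)"
    using assms by (auto simp: int_span_def)
  then have "a + b = (\<Sum>f\<in>F. zmul (v f + w f) f)"
    by (simp add: zmul_add sum.distrib)
  then show ?thesis by (auto simp: int_span_def)
qed

lemma int_span_diff:
  assumes "a \<in> int_span F" "b \<in> int_span F"
  shows "a - b \<in> int_span F"
proof -
  obtain v w where "a = (\<Sum>f\<in>F. zmul (v f) f)" "b = (\<Sum>f\<in>F. zmul (w f) f)"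
    using assms by (auto simp: int_span_def)
  then have "a - b = (\<Sum>f\<in>F. zmul (v f - w f) f)"
    by (simp add: zmul_diff sum_subtractf)
  then show ?thesis by (auto simp: int_span_def)
qed

lemma zmul_in_int_span: "finite F \<Longrightarrow> f \<in> F \<Longrightarrow> zmul n f \<in> int_span F"
  unfolding int_span_def
  by (rule range_eqI[of _ _ "\<lambda>h. if h = f then n else 0"])
    (simp add: if_distrib if_distribR sum.delta cong: if_cong)

section \<open>Weil's lemma\<close>

text \<open>The set may be unbounded on one side only; passing to differences makes the side
  irrelevant.\<close>

lemma infinite_int_gap:
  fixes S :: "int set"
  assumes "infinite S"
  obtains a b where "a \<in> S" "b \<in> S" "b < a - N"
proof -
  obtain c where c: "c \<in> S" using assms by fastforce
  have "\<not> S \<subseteq> {c - \<bar>N\<bar>..c + \<bar>N\<bar>}"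
    using assms finite_subset by blast
  then obtain d where d: "d \<in> S" "d < c - \<bar>N\<bar> \<or> c + \<bar>N\<bar> < d" by force
  from d(2) show ?thesis
    using c d(1) that by (elim disjE) force+
qed

lemma nhd_zero_diff:
  fixes W :: "'g::topological_group_add set"
  assumes "open W" "0 \<in> W"
  obtains V where "open V" "0 \<in> V" "\<And>a b. a \<in> V \<Longrightarrow> b \<in> V \<Longrightarrow> a - b \<in> W"
proof -
  have "open ((\<lambda>(a, b). a - b) -` W :: ('g \<times> 'g) set)"
    using assms(1) by (intro open_vimage) (auto simp: split_def intro!: continuous_intros)
  moreover have "(0, 0) \<in> ((\<lambda>(a, b). a - b) -` W :: ('g \<times> 'g) set)"
    using assms(2) by simp
  ultimately obtain A B where "open A" "open B" "(0, 0) \<in> A \<times> B" "A \<times> B \<subseteq> (\<lambda>(a, b). a - b) -` W"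
    by (rule open_prod_elim)
  then show ?thesis
    by (intro that[of "A \<inter> B"]) auto
qed

lemma open_translation_vimage:
  fixes W :: "'g::topological_group_add set"
  assumes "open W"
  shows "open {x. x - a \<in> W}" "open {x. a - x \<in> W}"
proof -
  have "open ((\<lambda>x. x - a) -` W)" "open ((\<lambda>x. a - x) -` W)"
    using assms by (auto intro!: open_vimage continuous_intros)
  then show "open {x. x - a \<in> W}" "open {x. a - x \<in> W}"
    by (simp_all add: vimage_def)
qed

lemma compact_translates_cover:
  fixes W :: "'g::topological_group_add set"
  assumes "compact B" "open W" "0 \<in> W"
  obtains T where "finite T" "\<And>x. x \<in> B \<Longrightarrow> \<exists>b\<in>T. x - b \<in> W"
proof -
  have "B \<subseteq> (\<Union>b\<in>B. {x. x - b \<in> W})" using assms(3) by auto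
  then obtain T where "T \<subseteq> B" "finite T" "B \<subseteq> (\<Union>b\<in>T. {x. x - b \<in> W})"
    using compactE_image[OF assms(1), of B "\<lambda>b. {x. x - b \<in> W}"] open_translation_vimage(1)[OF assms(2)]
    by blast
  then show ?thesis by (intro that[of T]) auto
qed

text \<open>Pigeonhole: modulo \<open>H\<close>, infinitely many multiples of \<open>f\<close> lie
  in \<open>B\<close>, which finitely many translates of a small \<open>V\<close> cover. Two of them
  with far apart coefficients share a translate, and their difference lies in \<open>H + W\<close>
  because V - V is contained in \<open>W\<close>.\<close>

lemma multiples_recurrent:
  fixes f :: "'g::topological_ab_group_add"
  assumes H: "\<And>a b. a \<in> H \<Longrightarrow> b \<in> H \<Longrightarrow> a - b \<in> H"
    and B: "compact B" and inf: "infinite {n. zmul n f \<in> H + B}"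
    and W: "open W" "0 \<in> W"
  obtains n h w where "N < n" "h \<in> H" "w \<in> W" "zmul n f = h + w"
proof -
  obtain V where V: "open V" "0 \<in> V" "\<And>a b. a \<in> V \<Longrightarrow> b \<in> V \<Longrightarrow> a - b \<in> W"
    using nhd_zero_diff[OF W] by blast
  obtain T where T: "finite T" "\<And>x. x \<in> B \<Longrightarrow> \<exists>b\<in>T. x - b \<in> V"
    using compact_translates_cover[OF B V(1,2)] by blast
  have "\<exists>b\<in>T. \<exists>h\<in>H. zmul n f - h - b \<in> V" if n: "n \<in> {n. zmul n f \<in> H + B}" for n
  proof -
    obtain h x where "h \<in> H" "x \<in> B" "zmul n f = h + x" using n by (auto elim: set_plus_elim)
    then show ?thesis using T(2)[of x] by (metis add_diff_cancel_left')
  qed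
  then obtain c where c: "\<And>n. n \<in> {n. zmul n f \<in> H + B} \<Longrightarrow> c n \<in> T \<and> (\<exists>h\<in>H. zmul n f - h - c n \<in> V)"
    by metis
  then have "c ` {n. zmul n f \<in> H + B} \<subseteq> T" by blast
  with T(1) have "finite (c ` {n. zmul n f \<in> H + B})" by (rule rev_finite_subset)
  \<comment> \<open>\<open>b\<close> is an index; the translate hit infinitely often is the one at
    \<open>c b\<close>.\<close>
  then obtain b where "infinite {n \<in> {n. zmul n f \<in> H + B}. c n = c b}"
    using pigeonhole_infinite[OF inf] by blast
  then obtain m l where m: "zmul m f \<in> H + B" "c m = c b" and l: "zmul l f \<in> H + B" "c l = c b"
    and ml: "l < m - N"
    using infinite_int_gap[of _ N] by (metis (mono_tags, lifting) mem_Collect_eq)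
  obtain h where h: "h \<in> H" "zmul m f - h - c b \<in> V" using c[of m] m by auto
  obtain k where k: "k \<in> H" "zmul l f - k - c b \<in> V" using c[of l] l by auto
  show ?thesis
  proof (rule that[of "m - l" "h - k" "(zmul m f - h - c b) - (zmul l f - k - c b)"])
    show "zmul (m - l) f = h - k + (zmul m f - h - c b - (zmul l f - k - c b))"
      by (simp add: zmul_diff)
    show "(zmul m f - h - c b) - (zmul l f - k - c b) \<in> W" using V(3) h k by blast
    show "h - k \<in> H" using H h k by blast
    show "N < m - l" using ml by simp
  qed
qed

text \<open>Relative form of Weil's lemma that a cyclic subgroup of a locally compact group is either
  discrete and infinite or relatively compact.\<close>

lemma Weil_relative:
  fixes f :: "'g::topological_ab_group_add"
  assumes H0: "0 \<in> H" and H: "\<And>a b. a \<in> H \<Longrightarrow> b \<in> H \<Longrightarrow> a - b \<in> H"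
    and U: "open (U :: 'g set)" "0 \<in> U" "U \<subseteq> K" "compact K"
    and B: "compact B" and inf: "infinite {n. zmul n f \<in> H + B}"
  shows "\<exists>L. compact L \<and> (\<forall>n. zmul n f \<in> H + L)"
proof -
  have Hadd: "a + b \<in> H" if "a \<in> H" "b \<in> H" for a b
    using H[OF that(1) H[OF H0 that(2)]] by simp
  \<comment> \<open>\<open>A\<close> is the subgroup generated by \<open>H\<close> and
    \<open>f\<close>. The open set \<open>O' m\<close> consists of the points that are
    \<open>U\<close>-close to the coset of \<open>zmul m f\<close>. Positive \<open>m\<close>
    already suffice to cover the closure of \<open>A\<close>, which is where recurrence
    enters.\<close>
  define A where "A = {zmul m f + h | m h. h \<in> H}"
  define O' where "O' m = (\<Union>h\<in>H. {x. x - (zmul m f + h) \<in> U})" for m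
  have "\<exists>m\<in>{0<..}. x \<in> O' m" if x: "x \<in> closure A" for x
  proof -
    have "open {y. x - y \<in> U}" "x \<in> {y. x - y \<in> U}"
      using U open_translation_vimage(2) by auto
    then have "{y. x - y \<in> U} \<inter> A \<noteq> {}"
      using x by (metis disjoint_iff open_Int_closure_eq_empty)
    then obtain m h where h: "h \<in> H" and u: "x - (zmul m f + h) \<in> U"
      by (auto simp: A_def)
    define u where "u = x - (zmul m f + h)"
    \<comment> \<open>Since \<open>u \<in> U\<close>, the set \<open>{w. u - w \<in> U}\<close> is a
      neighbourhood of 0. Recurrence into it shifts the coefficient \<open>m\<close> by an
      \<open>n\<close> large enough to make \<open>m + n\<close> positive, without leaving
      \<open>U\<close>.\<close>
    obtain n k w where n: "- m < n" "k \<in> H" "u - w \<in> U" "zmul n f = k + w"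
      using multiples_recurrent[OF H B inf, of "{w. u - w \<in> U}" "- m"] open_translation_vimage(2)[OF U(1)] u
      by (auto simp: u_def)
    have "x - (zmul (m + n) f + (h - k)) = u - w"
      by (simp add: u_def zmul_add n(4) algebra_simps)
    then have "x \<in> O' (m + n)" using n H h by (auto simp: O'_def intro!: bexI[of _ "h - k"])
    with n(1) show ?thesis by force
  qed
  then have cov: "K \<inter> closure A \<subseteq> (\<Union>m\<in>{0<..}. O' m)" by blast
  have op: "open (O' m)" for m
    unfolding O'_def using open_translation_vimage(1)[OF U(1)] by blast
  have cpt: "compact (K \<inter> closure A)" using U(4) by (simp add: compact_Int_closed)
  obtain S where S: "S \<subseteq> {0<..}" "finite S" "K \<inter> closure A \<subseteq> (\<Union>m\<in>S. O' m)"
    using compactE_image[OF cpt op cov] by metis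
  define M where "M = Max (insert 0 S)"
  have M: "m \<le> M" if "m \<in> S" for m using S(2) that by (simp add: M_def)
  \<comment> \<open>\<open>M\<close> will bound the time that any multiple of \<open>f\<close> needs
    to return to \<open>H + U\<close>, so finitely many shifts of \<open>K\<close> suffice.\<close>
  define L where "L = K + (\<lambda>i. - zmul i f) ` {0..M}"
  have "zmul n f \<in> H + L" for n
  proof -
    \<comment> \<open>The first return time \<open>k\<close> exists by recurrence. The point reached
      lies in some \<open>O' m\<close> with 0 < m \<le> M, so going back by \<open>m\<close> is
      again a return; if k > M, this contradicts the minimality of \<open>k\<close>.\<close>
    define P where "P k \<longleftrightarrow> zmul (n + int k) f \<in> H + U" for k
    obtain j h w where j: "n < j" "h \<in> H" "w \<in> U" "zmul j f = h + w"
      using multiples_recurrent[OF H B inf U(1,2), of n] by blast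
    then have "P (nat (j - n))" by (auto simp: P_def set_plus_intro)
    then have P: "P (LEAST k. P k)" by (rule LeastI)
    define k where "k = (LEAST k. P k)"
    obtain h u where hu: "h \<in> H" "u \<in> U" "zmul (n + int k) f = h + u"
      using P unfolding k_def[symmetric] unfolding P_def by (auto elim: set_plus_elim)
    then have "u = zmul (n + int k) f + (0 - h)" by simp
    then have "u \<in> A" unfolding A_def using H[OF H0 hu(1)] by blast
    then have "u \<in> K \<inter> closure A" using closure_subset hu(2) U(3) by blast
    then obtain m where m: "m \<in> S" "u \<in> O' m" using S(3) by blast
    then obtain h' where h': "h' \<in> H" "u - (zmul m f + h') \<in> U" by (auto simp: O'_def)
    have "int k \<le> M"
    proof (rule ccontr)
      assume "\<not> int k \<le> M"
      with M[OF m(1)] have mk: "m \<le> int k" by simp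
      have mpos: "0 < m" using m(1) S(1) by auto
      have "zmul (n + int (nat (int k - m))) f = (h + h') + (u - (zmul m f + h'))"
        using mk hu(3) by (simp add: zmul_add zmul_diff algebra_simps)
      then have "P (nat (int k - m))"
        unfolding P_def using h' hu(1) Hadd by (metis set_plus_intro)
      then have "k \<le> nat (int k - m)" unfolding k_def by (rule Least_le)
      with mpos mk show False by linarith
    qed
    then have "u + - zmul (int k) f \<in> L"
      unfolding L_def using hu(2) U(3) by (intro set_plus_intro imageI) auto
    moreover have "zmul n f = h + (u + - zmul (int k) f)"
      using hu(3) by (simp add: zmul_add algebra_simps)
    ultimately show ?thesis
      using hu(1) by (metis set_plus_intro)
  qed
  moreover have "compact L"
    unfolding L_def using U(4) by (simp add: compact_set_plus finite_imp_compact)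
  ultimately show ?thesis by blast
qed

section \<open>Coarse coordinates\<close>

text \<open>Properness of the map from integer vectors to the group. The case \<open>B = {0}\<close>
  forces a trivial kernel; for finite \<open>F\<close> in a locally compact Hausdorff group the
  condition says that \<open>F\<close> freely generates a discrete subgroup.\<close>

definition properly_independent :: "'g::topological_ab_group_add set \<Rightarrow> bool" where
  "properly_independent F \<longleftrightarrow>
     (\<forall>B. compact B \<longrightarrow> (\<exists>b. \<forall>v. (\<Sum>f\<in>F. zmul (v f) f) \<in> B \<longrightarrow> (\<forall>f\<in>F. \<bar>v f\<bar> \<le> b)))"

text \<open>The hypothesis leaves finitely many values for the coefficient of \<open>f\<close>.
  Subtracting these multiples of \<open>f\<close> from \<open>B\<close> gives a compact set, to
  which the independence of \<open>F\<close> applies.\<close>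

lemma properly_independent_insert:
  assumes F: "finite F" "f \<notin> F" "properly_independent F"
    and fin: "\<And>B. compact B \<Longrightarrow> finite {n. zmul n f \<in> int_span F + B}"
  shows "properly_independent (insert f F)"
  unfolding properly_independent_def
proof (intro allI impI)
  fix B :: "'a set"
  assume B: "compact B"
  define S where "S = {n. zmul n f \<in> int_span F + B}"
  have S: "finite S" unfolding S_def using fin[OF B] .
  have "compact (B + (\<lambda>n. zmul (- n) f) ` S)"
    using B S by (simp add: compact_set_plus finite_imp_compact)
  then obtain b where b: "\<forall>v. (\<Sum>f\<in>F. zmul (v f) f) \<in> B + (\<lambda>n. zmul (- n) f) ` S \<longrightarrow> (\<forall>f\<in>F. \<bar>v f\<bar> \<le> b)"
    using F(3) unfolding properly_independent_def by blast
  define b' where "b' = Max (insert 0 (abs ` S))"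
  show "\<exists>b. \<forall>v. (\<Sum>f\<in>insert f F. zmul (v f) f) \<in> B \<longrightarrow> (\<forall>f\<in>insert f F. \<bar>v f\<bar> \<le> b)"
  proof (intro exI allI impI ballI)
    fix v h
    assume v: "(\<Sum>f\<in>insert f F. zmul (v f) f) \<in> B" and h: "h \<in> insert f F"
    define x where "x = (\<Sum>f\<in>insert f F. zmul (v f) f)"
    have x: "x \<in> B" "x = zmul (v f) f + (\<Sum>f\<in>F. zmul (v f) f)"
      using v F by (auto simp: x_def)
    have "zmul (v f) f = (\<Sum>h\<in>F. zmul (- v h) h) + x"
      by (simp add: x(2) zmul_minus sum_negf)
    then have "v f \<in> S"
      unfolding S_def int_span_def using x(1) by (auto intro!: set_plus_intro)
    then have "\<bar>v f\<bar> \<le> b'" unfolding b'_def using S by simp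
    have "(\<Sum>f\<in>F. zmul (v f) f) = x + zmul (- v f) f"
      by (simp add: x(2) zmul_minus)
    with x(1) \<open>v f \<in> S\<close> have "(\<Sum>f\<in>F. zmul (v f) f) \<in> B + (\<lambda>n. zmul (- n) f) ` S"
      by (auto intro!: set_plus_intro)
    with b h \<open>\<bar>v f\<bar> \<le> b'\<close> show "\<bar>v h\<bar> \<le> max b b'"
      by (cases "h = f") fastforce+
  qed
qed

text \<open>For a symmetric compact \<open>L\<close> containing the generators and \<open>U\<close>,
  finitely many translates of \<open>U\<close> cover \<open>L + L\<close>. Their centres absorb the
  excess whenever an element of \<open>L\<close> is added to \<open>int_span F + L\<close>, so this
  set is closed under adding generators.\<close>

lemma finitely_generated_mod_compact:
  fixes K :: "'g::topological_ab_group_add set"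
  assumes U: "open U" "(0 :: 'g) \<in> U" "U \<subseteq> Kc" "compact Kc"
    and K: "compact K" "group_closure K = UNIV"
  obtains F :: "'g set" and L where "finite F" "compact L" "\<And>g. g \<in> int_span F + L"
proof -
  define L where "L = (K \<union> Kc) \<union> uminus ` (K \<union> Kc)"
  have L: "compact L" "K \<subseteq> L" "U \<subseteq> L" "0 \<in> L" "\<And>x. x \<in> L \<Longrightarrow> - x \<in> L"
    using K U compact_uminus_image[of "K \<union> Kc"] by (auto simp: L_def intro!: compact_Un)
  obtain F where F: "finite F" "\<And>x. x \<in> L + L \<Longrightarrow> \<exists>b\<in>F. x - b \<in> U"
    using compact_translates_cover[OF compact_set_plus[OF L(1) L(1)] U(1,2)] by blast
  define G where "G = int_span F + L"
  have step: "x + y \<in> G" if x: "x \<in> G" and y: "y \<in> L" for x y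
  proof -
    obtain a k where a: "a \<in> int_span F" "k \<in> L" "x = a + k"
      using x by (auto simp: G_def elim: set_plus_elim)
    obtain b where b: "b \<in> F" "k + y - b \<in> U"
      using F(2)[OF set_plus_intro[OF a(2) y]] by blast
    have "a + b \<in> int_span F"
      using int_span_add[OF a(1) zmul_in_int_span[OF F(1) b(1), of 1]] by simp
    moreover have "x + y = (a + b) + (k + y - b)" by (simp add: a(3) algebra_simps)
    ultimately show ?thesis unfolding G_def using b(2) L(3) by (metis set_plus_intro subsetD)
  qed
  \<comment> \<open>\<open>group_closure\<close> is generated by differences, so both signs are
    carried through the induction.\<close>
  have "\<forall>y\<in>G. y + x \<in> G \<and> y - x \<in> G" if "x \<in> group_closure K" for x
    using that
  proof induction
    case (base s)
    then have "s \<in> L" using L by auto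
    then show ?case using step[of _ s] step[of _ "- s"] L(5)[of s] by simp
  next
    case (diff s t)
    show ?case
    proof (intro ballI conjI)
      fix y assume "y \<in> G"
      then have "y + s - t \<in> G" "y + t - s \<in> G" using diff.IH by blast+
      then show "y + (s - t) \<in> G" "y - (s - t) \<in> G" by (simp_all add: algebra_simps)
    qed
  qed
  moreover have "0 \<in> G"
    unfolding G_def using set_plus_intro[OF zero_in_int_span L(4)] by simp
  ultimately have "x \<in> G" for x
    using K(2) by (metis UNIV_I add_0)
  then show ?thesis using that[OF F(1) L(1)] unfolding G_def by blast
qed

lemma int_span_mod_compact:
  assumes "finite F'"
    and "\<And>f. f \<in> F' \<Longrightarrow> \<exists>L. compact L \<and> (\<forall>n. zmul n f \<in> int_span F + L)"
  shows "\<exists>L :: 'g::topological_ab_group_add set. compact L \<and> int_span F' \<subseteq> int_span F + L"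
  using assms
proof (induction F' rule: finite_induct)
  case empty
  have "int_span {} \<subseteq> int_span F + {0}"
    using set_plus_intro[OF zero_in_int_span[of F], of 0 "{0}"] by (auto simp: int_span_def)
  then show ?case by (intro exI[of _ "{0}"]) simp
next
  case (insert f F')
  obtain L where L: "compact L" "int_span F' \<subseteq> int_span F + L" using insert by auto
  obtain M where M: "compact M" "\<And>n. zmul n f \<in> int_span F + M" using insert.prems[of f] by auto
  have "int_span (insert f F') \<subseteq> int_span F + (M + L)"
  proof
    fix x assume "x \<in> int_span (insert f F')"
    then obtain v where x: "x = (\<Sum>h\<in>insert f F'. zmul (v h) h)" by (auto simp: int_span_def)
    define y where "y = (\<Sum>h\<in>F'. zmul (v h) h)"
    have xy: "x = zmul (v f) f + y" using insert.hyps by (simp add: x y_def)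
    have "y \<in> int_span F + L" using L(2) by (auto simp: y_def int_span_def)
    then obtain a l where a: "a \<in> int_span F" "l \<in> L" "y = a + l" by (auto elim: set_plus_elim)
    obtain b m where b: "b \<in> int_span F" "m \<in> M" "zmul (v f) f = b + m"
      using M(2)[of "v f"] by (auto elim: set_plus_elim)
    have "x = (b + a) + (m + l)" by (simp add: xy a b algebra_simps)
    then show "x \<in> int_span F + (M + L)"
      using a b int_span_add by (metis set_plus_intro)
  qed
  then show ?case using compact_set_plus[OF M(1) L(1)] by blast
qed

text \<open>A maximal properly independent subset of a generating set gives a discrete free
  subgroup that is cocompact, by Weil's lemma; the coefficients of its elements serve as integer
  coordinates, which are only defined up to a bounded error.\<close>

lemma coarse_coordinates:
  fixes K :: "'g::topological_ab_group_add set"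
  assumes U: "open U" "(0 :: 'g) \<in> U" "U \<subseteq> Kc" "compact Kc"
    and K: "compact K" "group_closure K = UNIV"
  obtains F :: "'g set" and L c where "finite F" "compact L"
    "\<And>g. g - (\<Sum>f\<in>F. zmul (c g f) f) \<in> L"
    "\<And>C. compact C \<Longrightarrow> \<exists>b. \<forall>g h. g - h \<in> C \<longrightarrow> (\<forall>f\<in>F. \<bar>c g f - c h f\<bar> \<le> b)"
proof -
  obtain F' :: "'g set" and L where F': "finite F'" and L: "compact L" and gen: "\<And>g. g \<in> int_span F' + L"
    using finitely_generated_mod_compact[OF U K] by metis
  define A where "A = {F. F \<subseteq> F' \<and> properly_independent F}"
  have "finite A" unfolding A_def using F' by simp
  moreover have "{} \<in> A" by (auto simp: A_def properly_independent_def)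
  ultimately obtain F where F: "F \<in> A" and max: "\<And>E. E \<in> A \<Longrightarrow> F \<subseteq> E \<Longrightarrow> F = E"
    using finite_has_maximal[of A] by blast
  have finF: "finite F" and indep: "properly_independent F" and FF': "F \<subseteq> F'"
    using F F' finite_subset by (auto simp: A_def)
  have "\<exists>L. compact L \<and> (\<forall>n. zmul n f \<in> int_span F + L)" if f: "f \<in> F'" for f
  proof (cases "f \<in> F")
    case True
    then have "zmul n f \<in> int_span F + {0}" for n
      using set_plus_intro[OF zmul_in_int_span[OF finF True, of n], of 0 "{0}"] by simp
    then show ?thesis by (intro exI[of _ "{0}"]) simp
  next
    case False
    \<comment> \<open>By maximality \<open>f\<close> cannot be added, so infinitely many multiples
      of \<open>f\<close> stay within a compact distance of the span; Weil's lemma extends this to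
      all multiples.\<close>
    then have "insert f F \<notin> A" using max[of "insert f F"] by auto
    then have "\<not> properly_independent (insert f F)" using f FF' by (auto simp: A_def)
    then obtain B where "compact B" "infinite {n. zmul n f \<in> int_span F + B}"
      using properly_independent_insert[OF finF False indep] by blast
    then show ?thesis
      by (intro Weil_relative[OF zero_in_int_span _ U]) (auto intro: int_span_diff)
  qed
  then obtain M where M: "compact M" "int_span F' \<subseteq> int_span F + M"
    using int_span_mod_compact[OF F', of F] by blast
  define N where "N = M + L"
  have N: "compact N" unfolding N_def using M(1) L by (rule compact_set_plus)
  have "\<exists>v. g - (\<Sum>f\<in>F. zmul (v f) f) \<in> N" for g
  proof -
    obtain x l where x: "x \<in> int_span F'" "l \<in> L" "g = x + l"
      using gen[of g] by (rule set_plus_elim)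
    obtain a m where a: "a \<in> int_span F" "m \<in> M" "x = a + m"
      using subsetD[OF M(2) x(1)] by (rule set_plus_elim)
    obtain v where "a = (\<Sum>f\<in>F. zmul (v f) f)" using a(1) by (auto simp: int_span_def)
    then have "g - (\<Sum>f\<in>F. zmul (v f) f) = m + l" by (simp add: x a)
    then show ?thesis unfolding N_def using a(2) x(2) by (metis set_plus_intro)
  qed
  then obtain c where c: "\<And>g. g - (\<Sum>f\<in>F. zmul (c g f) f) \<in> N" by metis
  show ?thesis
  proof (rule that[OF finF N c])
    fix C :: "'g set"
    assume "compact C"
    then have "compact (C + (uminus ` N + N))"
      using N by (intro compact_set_plus compact_uminus_image)
    then obtain b where b: "\<forall>v. (\<Sum>f\<in>F. zmul (v f) f) \<in> C + (uminus ` N + N) \<longrightarrow> (\<forall>f\<in>F. \<bar>v f\<bar> \<le> b)"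
      using indep unfolding properly_independent_def by blast
    show "\<exists>b. \<forall>g h. g - h \<in> C \<longrightarrow> (\<forall>f\<in>F. \<bar>c g f - c h f\<bar> \<le> b)"
    proof (intro exI allI impI)
      fix g h assume gh: "g - h \<in> C"
      \<comment> \<open>The lattice points chosen for \<open>g\<close> and \<open>h\<close> have
        errors in \<open>N\<close>, so their difference lies in a compact set depending on
        \<open>C\<close> only. Proper independence turns this into a bound on the
        coefficients.\<close>
      have "(\<Sum>f\<in>F. zmul (c g f - c h f) f) =
          (g - h) + (- (g - (\<Sum>f\<in>F. zmul (c g f) f)) + (h - (\<Sum>f\<in>F. zmul (c h f) f)))"
        by (simp add: zmul_diff sum_subtractf)
      moreover have "\<dots> \<in> C + (uminus ` N + N)"
        by (intro set_plus_intro imageI gh c)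
      ultimately have "(\<Sum>f\<in>F. zmul (c g f - c h f) f) \<in> C + (uminus ` N + N)" by simp
      then show "\<forall>f\<in>F. \<bar>c g f - c h f\<bar> \<le> b"
        by (rule b[THEN spec[of _ "\<lambda>f. c g f - c h f"], THEN mp])
    qed
  qed
qed

section \<open>Contracting a half-space\<close>

text \<open>The images under \<open>p\<close> and \<open>q\<close> of a simplex of \<open>G\<^sub>\<xi> \<cdot> E C\<close> lie in a common translate of \<open>D\<close>,
  so that their join is a simplex of \<open>G\<^sub>\<xi> \<cdot> E D\<close> and contains a homotopy between them.\<close>

definition homotopy_step ::
  "('g::topological_group_add \<Rightarrow> real) \<Rightarrow> 'g set \<Rightarrow> 'g set \<Rightarrow> ('g \<Rightarrow> 'g) \<Rightarrow> ('g \<Rightarrow> 'g) \<Rightarrow> bool" where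
  "homotopy_step \<xi> C D p q \<longleftrightarrow>
     (\<forall>g\<in>halfspace \<xi>. p g \<in> halfspace \<xi> \<and>
        (\<forall>y\<in>C. \<exists>a\<in>D. \<exists>b\<in>D. p (g + y) = p g + a \<and> q (g + y) = p g + b))"

lemma homotopy_stepI:
  fixes \<xi> :: "'g::topological_ab_group_add \<Rightarrow> real"
  assumes "\<And>g. 0 \<le> \<xi> g \<Longrightarrow> 0 \<le> \<xi> (p g)"
    and "\<And>g y. y \<in> C \<Longrightarrow> p (g + y) - p g \<in> D"
    and "\<And>g y. y \<in> C \<Longrightarrow> q (g + y) - p g \<in> D"
  shows "homotopy_step \<xi> C D p q"
  unfolding homotopy_step_def halfspace_def
  using assms by (metis (no_types, lifting) add.commute diff_add_cancel mem_Collect_eq)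

text \<open>\<open>D\<close> is fixed before \<open>V\<close>; the finite set \<open>V\<close>
  influences only the length of the chain. The chain consists of translations \<open>\<tau>\<close>,
  of the shrinking maps \<open>\<sigma>\<close>, and of one collapse \<open>q\<close>.\<close>

lemma halfspace_contraction:
  fixes \<xi> :: "'g::topological_ab_group_add \<Rightarrow> real"
  assumes \<xi>: "\<And>g h. \<xi> (g + h) = \<xi> g + \<xi> h"
    and F: "finite (F :: 'g set)" and K: "compact (K :: 'g set)"
    and cK: "\<And>g. g - (\<Sum>f\<in>F. zmul (c g f) f) \<in> K"
    and cc: "\<And>C. compact C \<Longrightarrow> \<exists>b. \<forall>g h. g - h \<in> C \<longrightarrow> (\<forall>f\<in>F. \<bar>c g f - c h f\<bar> \<le> b)"
    and C: "compact C"
  shows "\<exists>D. compact D \<and> C \<subseteq> D \<and>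
    (\<forall>V. finite V \<longrightarrow> (\<exists>q y. (homotopy_step \<xi> C D)\<^sup>*\<^sup>* id q \<and> (\<forall>v\<in>V. q v = y)))"
proof -
  have \<xi>0: "\<xi> 0 = 0" using \<xi>[of 0 0] by simp
  have \<xi>neg: "\<xi> (- g) = - \<xi> g" for g using \<xi>[of g "- g"] \<xi>0 by simp
  have \<xi>diff: "\<xi> (g - h) = \<xi> g - \<xi> h" for g h using \<xi>[of g "- h"] \<xi>neg by simp
  have \<xi>sum: "\<xi> (\<Sum>f\<in>A. u f) = (\<Sum>f\<in>A. \<xi> (u f))" for A and u :: "'g \<Rightarrow> 'g"
    using \<xi> \<xi>0 by (induction A rule: infinite_finite_induct) auto
  obtain t where t: "0 \<le> \<xi> t" "(\<forall>g. \<xi> g = 0) \<or> 0 < \<xi> t"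
  proof (cases "\<forall>g. \<xi> g = 0")
    case False
    then obtain g where "\<xi> g \<noteq> 0" by blast
    then show ?thesis using that[of g] that[of "- g"] \<xi>neg[of g] by (cases "0 < \<xi> g") auto
  qed (use that in auto)
  obtain b where b: "\<And>g h f. g - h \<in> C \<Longrightarrow> f \<in> F \<Longrightarrow> \<bar>c g f - c h f\<bar> \<le> b"
    using cc[OF C] by blast
  \<comment> \<open>The bound is \<open>b\<close> for the change of a coordinate along
    \<open>C\<close>, plus 1 for the change of clipping level between consecutive maps.\<close>
  define E where "E = (\<lambda>v. \<Sum>f\<in>F. zmul (v f) f) ` (F \<rightarrow>\<^sub>E {- (b + 1)..b + 1})"
  have "finite E" unfolding E_def using F by (intro finite_imageI finite_PiE) auto
  have E: "(\<Sum>f\<in>F. zmul (v f) f) \<in> E" if "\<And>f. f \<in> F \<Longrightarrow> \<bar>v f\<bar> \<le> b + 1" for v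
  proof -
    have "restrict v F \<in> F \<rightarrow>\<^sub>E {- (b + 1)..b + 1}"
      using that by (auto simp: abs_le_iff) (smt (verit))
    moreover have "(\<Sum>f\<in>F. zmul (v f) f) = (\<Sum>f\<in>F. zmul (restrict v F f) f)" by simp
    ultimately show ?thesis unfolding E_def by blast
  qed
  \<comment> \<open>The four parts serve, in order, the translation \<open>\<tau> i\<close> itself,
    its successor, the shrinking maps, and the final collapse.\<close>
  define D where "D = C \<union> (C + {t}) \<union> (C + E) \<union> ((C + E) + uminus ` K)"
  have "compact D"
    unfolding D_def using C K finite_imp_compact[OF \<open>finite E\<close>]
    by (intro compact_Un compact_set_plus compact_uminus_image) auto
  \<comment> \<open>Subtracting \<open>s i g\<close> moves each coordinate by at most
    \<open>i\<close> towards 0. Level 0 subtracts nothing; at a level above all coordinates of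
    \<open>g\<close> only the error term in \<open>K\<close> remains.\<close>
  define clip where "clip i z = max (- int i) (min (int i) z)" for i z
  define s where "s i g = (\<Sum>f\<in>F. zmul (clip i (c g f)) f)" for i g
  have s: "s i g - s j (g + y) \<in> E" if "y \<in> C" "j = i \<or> j = Suc i" for i j g y
  proof -
    have "s i g - s j (g + y) = (\<Sum>f\<in>F. zmul (clip i (c g f) - clip j (c (g + y) f)) f)"
      by (simp add: s_def zmul_diff sum_subtractf)
    also have "\<dots> \<in> E"
    proof (rule E)
      fix f assume "f \<in> F"
      then have "\<bar>c (g + y) f - c g f\<bar> \<le> b" using b[of "g + y" g f] that(1) by simp
      then show "\<bar>clip i (c g f) - clip j (c (g + y) f)\<bar> \<le> b + 1"
        using that(2) unfolding clip_def by auto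
    qed
    finally show ?thesis .
  qed
  have "\<exists>q y. (homotopy_step \<xi> C D)\<^sup>*\<^sup>* id q \<and> (\<forall>v\<in>V. q v = y)" if V: "finite V" for V
  proof -
    \<comment> \<open>\<open>N\<close> bounds all coordinates of points of \<open>V\<close>; the
      inserted 0 covers the case that there are none.\<close>
    define N where "N = nat (Max (insert 0 ((\<lambda>(v, f). \<bar>c v f\<bar>) ` (V \<times> F))))"
    have N: "\<bar>c v f\<bar> \<le> int N" if "v \<in> V" "f \<in> F" for v f
    proof -
      have "\<bar>c v f\<bar> \<le> Max (insert 0 ((\<lambda>(v, f). \<bar>c v f\<bar>) ` (V \<times> F)))"
        using V F that by (intro Max_ge) (auto intro!: image_eqI[of _ _ "(v, f)"])
      then show ?thesis unfolding N_def by linarith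
    qed
    \<comment> \<open>The right number of translations by \<open>t\<close>: subtracting
      \<open>s i g\<close> with \<open>i \<le> N\<close> lowers the character by at most the
      left-hand side.\<close>
    obtain m :: nat where m: "real N * (\<Sum>f\<in>F. \<bar>\<xi> f\<bar>) \<le> real m * \<xi> t"
    proof (cases "\<forall>g. \<xi> g = 0")
      case True
      then show ?thesis using that[of 0] by simp
    next
      case False
      then have "0 < \<xi> t" using t by blast
      then show ?thesis using reals_Archimedean3[of "\<xi> t"] that less_imp_le by blast
    qed
    define \<tau> where "\<tau> i g = g + zmul (int i) t" for i g
    have "homotopy_step \<xi> C D (\<tau> i) (\<tau> (Suc i))" for i
    proof (rule homotopy_stepI)
      show "0 \<le> \<xi> (\<tau> i g)" if "0 \<le> \<xi> g" for g
        using that t(1) by (simp add: \<tau>_def \<xi> zmul_hom[OF \<xi>])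
      show "\<tau> i (g + y) - \<tau> i g \<in> D" if "y \<in> C" for g y
        using that by (simp add: \<tau>_def D_def)
      show "\<tau> (Suc i) (g + y) - \<tau> i g \<in> D" if "y \<in> C" for g y
      proof -
        have "\<tau> (Suc i) (g + y) - \<tau> i g = y + t"
          by (simp add: \<tau>_def zmul_add)
        then show ?thesis using that by (auto simp: D_def intro: set_plus_intro)
      qed
    qed
    moreover have "\<tau> 0 = id" by (auto simp: \<tau>_def)
    ultimately have up: "(homotopy_step \<xi> C D)\<^sup>*\<^sup>* id (\<tau> i)" for i
      by (induction i) (auto intro: rtranclp.rtrancl_into_rtrancl)
    define \<sigma> where "\<sigma> i g = g - s i g + zmul (int m) t" for i g
    have \<sigma>pos: "0 \<le> \<xi> (\<sigma> i g)" if "i \<le> N" "0 \<le> \<xi> g" for i g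
    proof -
      have "\<xi> (s i g) = (\<Sum>f\<in>F. of_int (clip i (c g f)) * \<xi> f)"
        by (simp add: s_def \<xi>sum zmul_hom[OF \<xi>])
      also have "\<dots> \<le> (\<Sum>f\<in>F. real N * \<bar>\<xi> f\<bar>)"
      proof (rule sum_mono)
        fix f
        have "\<bar>clip i (c g f)\<bar> \<le> int N" using that(1) by (auto simp: clip_def)
        then have "\<bar>of_int (clip i (c g f)) :: real\<bar> \<le> real N" by linarith
        then have "\<bar>of_int (clip i (c g f)) * \<xi> f\<bar> \<le> real N * \<bar>\<xi> f\<bar>"
          by (simp add: abs_mult mult_right_mono)
        then show "of_int (clip i (c g f)) * \<xi> f \<le> real N * \<bar>\<xi> f\<bar>" by linarith
      qed
      finally show ?thesis
        using m that(2) by (simp add: \<sigma>_def \<xi> \<xi>diff zmul_hom[OF \<xi>] sum_distrib_left)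
    qed
    have \<sigma>D: "\<sigma> j (g + y) - \<sigma> i g \<in> C + E" if "y \<in> C" "j = i \<or> j = Suc i" for i j g y
    proof -
      have "\<sigma> j (g + y) - \<sigma> i g = y + (s i g - s j (g + y))"
        by (simp add: \<sigma>_def algebra_simps)
      then show ?thesis using s[OF that] that(1) by (metis set_plus_intro)
    qed
    have "homotopy_step \<xi> C D (\<sigma> i) (\<sigma> (Suc i))" if "i < N" for i
      using that \<sigma>pos[of i] \<sigma>D by (intro homotopy_stepI) (auto simp: D_def)
    moreover have "\<sigma> 0 = \<tau> m"
      by (auto simp: \<sigma>_def \<tau>_def s_def clip_def)
    ultimately have "(homotopy_step \<xi> C D)\<^sup>*\<^sup>* id (\<sigma> i)" if "i \<le> N" for i
      using that up[of m] by (induction i) (auto intro: rtranclp.rtrancl_into_rtrancl)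
    then have contr: "(homotopy_step \<xi> C D)\<^sup>*\<^sup>* id (\<sigma> N)" by simp
    \<comment> \<open>All points whose remainder lies in \<open>K\<close>, among them all of
      \<open>V\<close>, go to one point. As the second map of the last step, \<open>q\<close> is
      compared with translates by \<open>\<sigma> N g\<close>, and it is these that lie in the
      half-space.\<close>
    define q where "q g = (if g - s N g \<in> K then zmul (int m) t else \<sigma> N g)" for g
    have "homotopy_step \<xi> C D (\<sigma> N) q"
    proof (rule homotopy_stepI)
      show "0 \<le> \<xi> (\<sigma> N g)" if "0 \<le> \<xi> g" for g using \<sigma>pos that by simp
      show "\<sigma> N (g + y) - \<sigma> N g \<in> D" if "y \<in> C" for g y
        using \<sigma>D[OF that] by (simp add: D_def)
      show "q (g + y) - \<sigma> N g \<in> D" if "y \<in> C" for g y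
      proof (cases "g + y - s N (g + y) \<in> K")
        case True
        have "q (g + y) - \<sigma> N g = (\<sigma> N (g + y) - \<sigma> N g) + - (g + y - s N (g + y))"
          using True by (simp add: q_def \<sigma>_def algebra_simps)
        then have "q (g + y) - \<sigma> N g \<in> (C + E) + uminus ` K"
          using \<sigma>D[OF that] True by (metis image_eqI set_plus_intro)
        then show ?thesis by (simp add: D_def)
      next
        case False
        then show ?thesis using \<sigma>D[OF that] by (simp add: D_def q_def)
      qed
    qed
    with contr have "(homotopy_step \<xi> C D)\<^sup>*\<^sup>* id q" by simp
    moreover have "q v = zmul (int m) t" if "v \<in> V" for v
    proof -
      have "clip N (c v f) = c v f" if "f \<in> F" for f
        using N[OF \<open>v \<in> V\<close> that] by (auto simp: clip_def)
      then have "s N v = (\<Sum>f\<in>F. zmul (c v f) f)" by (simp add: s_def)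
      then show ?thesis using cK[of v] by (simp add: q_def)
    qed
    ultimately show ?thesis by blast
  qed
  moreover have "C \<subseteq> D" by (auto simp: D_def)
  ultimately show ?thesis using \<open>compact D\<close> by blast
qed

section \<open>Points of the realization as weighted lists\<close>

text \<open>On weighted lists the two kinds of gluing are list operations: deleting an entry of
  weight 0, and merging adjacent entries with the same vertex.\<close>

definition weights :: "nat \<times> 'a list \<times> (nat \<Rightarrow> real) \<Rightarrow> ('a \<times> real) list" where
  "weights = (\<lambda>(n, xs, t). zip xs (map t [0..<Suc n]))"

text \<open>The value 0 beyond the list is demanded by \<open>standard_simplex\<close>; with it,
  \<open>point\<close> inverts \<open>weights\<close> on cells.\<close>

definition point :: "('a \<times> real) list \<Rightarrow> nat \<times> 'a list \<times> (nat \<Rightarrow> real)" where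
  "point L = (length L - 1, map fst L, \<lambda>i. if i < length L then snd (L ! i) else 0)"

definition weighted_simplex :: "'a list sset \<Rightarrow> ('a \<times> real) list \<Rightarrow> bool" where
  "weighted_simplex X L \<longleftrightarrow> L \<noteq> [] \<and> map fst L \<in> simplices X (length L - 1) \<and>
     (\<forall>a\<in>set L. 0 \<le> snd a) \<and> sum_list (map snd L) = 1"

abbreviation point_class :: "'a list sset \<Rightarrow> ('a \<times> real) list \<Rightarrow> (nat \<times> 'a list \<times> (nat \<Rightarrow> real)) set"
  where "point_class X L \<equiv> glue_rel X `` {point L}"

lemma topspace_cells_iff:
  "(n, x, t) \<in> topspace (cells X) \<longleftrightarrow> x \<in> simplices X n \<and> t \<in> standard_simplex n"
  by (simp add: cells_def)

lemma simplices_translates: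
  "xs \<in> simplices (translates_E M C) n \<longleftrightarrow>
     length xs = Suc n \<and> (\<exists>g\<in>M. \<forall>x\<in>set xs. \<exists>y\<in>C. x = g + y)"
proof
  assume "xs \<in> simplices (translates_E M C) n"
  then show "length xs = Suc n \<and> (\<exists>g\<in>M. \<forall>x\<in>set xs. \<exists>y\<in>C. x = g + y)"
    by (force simp: translates_E_def simplices_E)
next
  assume xs: "length xs = Suc n \<and> (\<exists>g\<in>M. \<forall>x\<in>set xs. \<exists>y\<in>C. x = g + y)"
  then obtain g where g: "g \<in> M" "\<And>x. x \<in> set xs \<Longrightarrow> \<exists>y\<in>C. x = g + y" by blast
  have "xs = map ((+) g) (map (\<lambda>x. - g + x) xs)"
    by (simp add: map_idI)
  moreover have "map (\<lambda>x. - g + x) xs \<in> simplices (E_sset C) n"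
    using xs g(2) by (force simp: simplices_E)
  ultimately show "xs \<in> simplices (translates_E M C) n"
    using g(1) unfolding translates_E_def by (auto simp del: map_map)
qed

lemma face_translates: "face (translates_E M C) n i xs = take i xs @ drop (Suc i) xs"
  and degen_translates: "degen (translates_E M C) n i xs = take (Suc i) xs @ drop i xs"
  by (simp_all add: translates_E_def E_sset_def)

lemma simplices_translates_subset:
  assumes "xs \<in> simplices (translates_E M C) n" "set ys \<subseteq> set xs" "length ys = Suc m"
  shows "ys \<in> simplices (translates_E M C) m"
  using assms unfolding simplices_translates by blast

text \<open>Whether vertices lie in a common translate of \<open>C\<close> depends only on the set
  of vertices, so entries may be deleted, repeated or rearranged freely.\<close>

lemma weighted_simplex_subset:
  assumes "weighted_simplex (translates_E M C) L" "K \<noteq> []" "fst ` set K \<subseteq> fst ` set L"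
    "\<And>a. a \<in> set K \<Longrightarrow> 0 \<le> snd a" "sum_list (map snd K) = 1"
  shows "weighted_simplex (translates_E M C) K"
  unfolding weighted_simplex_def
proof (intro conjI)
  show "map fst K \<in> simplices (translates_E M C) (length K - 1)"
  proof (rule simplices_translates_subset)
    show "map fst L \<in> simplices (translates_E M C) (length L - 1)"
      using assms(1) by (simp add: weighted_simplex_def)
  qed (use assms(2,3) in simp_all)
qed (use assms in auto)

lemma point_in_cells:
  assumes "weighted_simplex X L"
  shows "point L \<in> topspace (cells X)"
proof -
  have L: "L \<noteq> []" "map fst L \<in> simplices X (length L - 1)" "\<And>a. a \<in> set L \<Longrightarrow> 0 \<le> snd a"
    "sum_list (map snd L) = 1"
    using assms by (auto simp: weighted_simplex_def)
  have "{..length L - 1} = {0..<length L}" using L(1) by (cases L) auto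
  then have "(\<Sum>i\<le>length L - 1. if i < length L then snd (L ! i) else 0) = 1"
    using L(4) by (simp add: sum_list_sum_nth)
  moreover have "snd (L ! i) \<le> 1" if "i < length L" for i
    using member_le_sum_list[of "snd (L ! i)" "map snd L"] L(3,4) that by force
  moreover have "\<not> i < length L" if "i > length L - 1" for i using that by simp
  ultimately have "(\<lambda>i. if i < length L then snd (L ! i) else 0) \<in> standard_simplex (length L - 1)"
    using L(3) unfolding standard_simplex_def by auto
  then show ?thesis using L(2) by (simp add: point_def topspace_cells_iff)
qed

lemma weights_cells:
  assumes "P \<in> topspace (cells (translates_E M C))"
  shows "weighted_simplex (translates_E M C) (weights P)" "point (weights P) = P"
proof -
  obtain n xs t where P: "P = (n, xs, t)" by (cases P) auto
  have xs: "xs \<in> simplices (translates_E M C) n" and t: "t \<in> standard_simplex n"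
    using assms by (auto simp: P topspace_cells_iff)
  have len: "length xs = Suc n" using xs by (simp add: simplices_translates)
  have *: "map fst (weights P) = xs" "map snd (weights P) = map t [0..<Suc n]" "length (weights P) = Suc n"
    using len by (simp_all add: weights_def P)
  have "sum_list (map snd (weights P)) = (\<Sum>i\<le>n. t i)"
    unfolding * by (simp only: interv_sum_list_conv_sum_set_nat atLeast0LessThan lessThan_Suc_atMost set_upt)
  moreover have "0 \<le> snd a" if "a \<in> set (weights P)" for a
  proof -
    have "snd a \<in> set (map snd (weights P))" using that by simp
    then show ?thesis unfolding * using t by (auto simp: standard_simplex_def)
  qed
  ultimately show "weighted_simplex (translates_E M C) (weights P)"
    using t xs * unfolding weighted_simplex_def
    by (auto simp: standard_simplex_def simp del: length_0_conv)
  have "(\<lambda>i. if i < Suc n then snd (weights P ! i) else 0) = t"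
  proof
    fix i
    show "(if i < Suc n then snd (weights P ! i) else 0) = t i"
      using t len by (auto simp: weights_def P standard_simplex_def simp del: upt_Suc)
  qed
  then show "point (weights P) = P"
    unfolding point_def * by (simp add: P)
qed

lemma glue_drop_zero:
  assumes L: "weighted_simplex (translates_E M C) (A @ (x, 0) # B)" and AB: "A @ B \<noteq> []"
  shows "glue (translates_E M C) (point (A @ B)) (point (A @ (x, 0) # B))"
proof -
  obtain n where n: "length A + length B = Suc n"
    using AB by (metis append_is_Nil_conv length_0_conv length_append not0_implies_Suc)
  define t where "t = (\<lambda>i. if i < length (A @ B) then snd ((A @ B) ! i) else 0)"
  have "weighted_simplex (translates_E M C) (A @ B)"
    using L AB by (intro weighted_simplex_subset[OF L]) (auto simp: weighted_simplex_def)
  then have t: "t \<in> standard_simplex n"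
    using point_in_cells[of "translates_E M C" "A @ B"] n
    by (simp add: point_def topspace_cells_iff t_def)
  have "simplical_face (length A) t = (\<lambda>i. if i < length (A @ (x, 0) # B) then snd ((A @ (x, 0) # B) ! i) else 0)"
  proof
    fix i
    consider "i < length A" | "i = length A" | j where "i = Suc (length A + j)"
      by (metis add_Suc_right less_imp_Suc_add linorder_neqE_nat)
    then show "simplical_face (length A) t i =
        (if i < length (A @ (x, 0) # B) then snd ((A @ (x, 0) # B) ! i) else 0)"
      by cases (simp_all add: simplical_face_def t_def nth_append)
  qed
  then have 1: "point (A @ (x, 0) # B) =
      (Suc n, map fst A @ x # map fst B, simplical_face (length A) t)"
    using n by (simp add: point_def)
  have 2: "point (A @ B) =
      (n, face (translates_E M C) (Suc n) (length A) (map fst A @ x # map fst B), t)"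
    using n by (simp add: point_def face_translates t_def)
  show ?thesis
    unfolding 1 2
  proof (rule glue_face)
    show "map fst A @ x # map fst B \<in> simplices (translates_E M C) (Suc n)"
      using L n by (simp add: weighted_simplex_def)
  qed (use n t in auto)
qed

lemma glue_merge:
  assumes L: "weighted_simplex (translates_E M C) (A @ (x, a + b) # B)" and ab: "0 \<le> a" "0 \<le> b"
  shows "glue (translates_E M C) (point (A @ (x, a) # (x, b) # B)) (point (A @ (x, a + b) # B))"
proof -
  define n where "n = length A + length B"
  define K where "K = A @ (x, a) # (x, b) # B"
  define t where "t = (\<lambda>i. if i < length K then snd (K ! i) else 0)"
  have "weighted_simplex (translates_E M C) K"
    unfolding K_def using L ab by (intro weighted_simplex_subset[OF L]) (auto simp: weighted_simplex_def)
  then have t: "t \<in> standard_simplex (Suc n)"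
    using point_in_cells[of "translates_E M C" K]
    by (simp add: point_def topspace_cells_iff t_def) (simp add: n_def K_def)
  have "simplicial_codegen (length A) t =
      (\<lambda>i. if i < length (A @ (x, a + b) # B) then snd ((A @ (x, a + b) # B) ! i) else 0)"
  proof
    fix i
    consider "i < length A" | "i = length A" | j where "i = Suc (length A + j)"
      by (metis add_Suc_right less_imp_Suc_add linorder_neqE_nat)
    then show "simplicial_codegen (length A) t i =
        (if i < length (A @ (x, a + b) # B) then snd ((A @ (x, a + b) # B) ! i) else 0)"
      by cases (simp_all add: simplicial_codegen_def t_def K_def nth_append)
  qed
  then have 1: "point (A @ (x, a + b) # B) =
      (n, map fst A @ x # map fst B, simplicial_codegen (length A) t)"
    by (simp add: point_def n_def)
  have 2: "point (A @ (x, a) # (x, b) # B) =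
      (Suc n, degen (translates_E M C) n (length A) (map fst A @ x # map fst B), t)"
    unfolding t_def K_def by (simp add: point_def degen_translates n_def)
  show ?thesis
    unfolding 1 2
  proof (rule glue_degen)
    show "map fst A @ x # map fst B \<in> simplices (translates_E M C) n"
      using L by (simp add: weighted_simplex_def n_def)
  qed (use t in \<open>auto simp: n_def\<close>)
qed

text \<open>The converse of \<open>glue_drop_zero\<close> and \<open>glue_merge\<close>: invariance
  under gluing need only be checked for these two list operations.\<close>

lemma glue_weights_cases:
  assumes "glue (translates_E M C) P Q"
  obtains (drop_zero) A B x where "weights P = A @ B" "weights Q = A @ (x, 0) # B" "A @ B \<noteq> []"
  | (merge) A B x a b where "weights P = A @ (x, a) # (x, b) # B" "weights Q = A @ (x, a + b) # B"
      "0 \<le> a" "0 \<le> b"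
  using assms
proof cases
  case (glue_face xs n i t)
  have len: "length xs = Suc (Suc n)" using glue_face by (simp add: simplices_translates)
  have lP: "length (weights P) = Suc n" and lQ: "length (weights Q) = Suc (Suc n)"
    using glue_face len by (simp_all add: weights_def face_translates)
  define A B where "A = take i (weights Q)" and "B = drop (Suc i) (weights Q)"
  have "weights Q ! i = (xs ! i, 0)"
    using glue_face len by (simp add: weights_def simplical_face_def del: upt_Suc)
  then have Q: "weights Q = A @ (xs ! i, 0) # B"
    unfolding A_def B_def using lQ glue_face(4) by (metis id_take_nth_drop le_imp_less_Suc)
  have P: "weights P = A @ B"
  proof (rule nth_equalityI)
    show "length (weights P) = length (A @ B)" using lP lQ glue_face(4) by (simp add: A_def B_def)
    fix k assume "k < length (weights P)"
    then show "weights P ! k = (A @ B) ! k"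
      using lP lQ glue_face len
      by (auto simp: A_def B_def weights_def face_translates simplical_face_def nth_append
          simp del: upt_Suc)
  qed
  have "A @ B \<noteq> []" using P lP by (metis length_0_conv nat.distinct(1))
  with P Q show ?thesis by (rule drop_zero)
next
  case (glue_degen xs n i t)
  have len: "length xs = Suc n" using glue_degen by (simp add: simplices_translates)
  have lP: "length (weights P) = Suc (Suc n)" and lQ: "length (weights Q) = Suc n"
    using glue_degen len by (simp_all add: weights_def degen_translates)
  define A B where "A = take i (weights Q)" and "B = drop (Suc i) (weights Q)"
  have "weights Q ! i = (xs ! i, t i + t (Suc i))"
    using glue_degen len by (simp add: weights_def simplicial_codegen_def del: upt_Suc)
  then have Q: "weights Q = A @ (xs ! i, t i + t (Suc i)) # B"
    unfolding A_def B_def using lQ glue_degen(4) by (metis id_take_nth_drop le_imp_less_Suc)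
  have P: "weights P = A @ (xs ! i, t i) # (xs ! i, t (Suc i)) # B"
  proof (rule nth_equalityI)
    show "length (weights P) = length (A @ (xs ! i, t i) # (xs ! i, t (Suc i)) # B)"
      using lP lQ glue_degen(4) by (simp add: A_def B_def)
    fix k assume k: "k < length (weights P)"
    consider "k < i" | "k = i" | "k = Suc i" | j where "k = Suc (Suc (i + j))"
      by (metis add_Suc_right less_imp_Suc_add linorder_neqE_nat not_less_eq)
    then show "weights P ! k = (A @ (xs ! i, t i) # (xs ! i, t (Suc i)) # B) ! k"
      using k lP lQ glue_degen len
      by cases (simp_all add: A_def B_def weights_def degen_translates simplicial_codegen_def
          nth_append del: upt_Suc)
  qed
  have "0 \<le> t i" "0 \<le> t (Suc i)" using glue_degen(5) by (simp_all add: standard_simplex_def)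
  with P Q show ?thesis by (rule merge)
qed

section \<open>Equality of classes in the realization\<close>

lemma glue_rel_eq_iff: "glue_rel X `` {P} = glue_rel X `` {Q} \<longleftrightarrow> equivclp (glue X) P Q"
  by (auto simp: glue_rel_def intro: equivclp_trans equivclp_sym)

lemma glue_class_eq: "glue X P Q \<Longrightarrow> glue_rel X `` {P} = glue_rel X `` {Q}"
  unfolding glue_rel_eq_iff by (rule r_into_equivclp)

lemma glue_invariant:
  assumes "glue_rel X `` {P} = glue_rel X `` {Q}" and "\<And>P Q. glue X P Q \<Longrightarrow> f P = f Q"
  shows "f P = f Q"
proof -
  have "equivclp (glue X) P Q" using assms(1) by (simp add: glue_rel_eq_iff)
  then show ?thesis by (induction rule: equivclp_induct) (auto simp: assms(2))
qed

text \<open>Induction on the length, looking at the first two entries: one of weight 0 can be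
  deleted, whatever its vertex, and two of positive weight both sit at \<open>y\<close> and can be
  merged.\<close>

lemma point_class_const:
  assumes "weighted_simplex (translates_E M C) L"
    and "\<And>x a. (x, a) \<in> set L \<Longrightarrow> 0 < a \<Longrightarrow> x = y"
  shows "point_class (translates_E M C) L = point_class (translates_E M C) [(y, 1)]"
  using assms
proof (induction "length L" arbitrary: L rule: less_induct)
  case less
  have red: "point_class (translates_E M C) L = point_class (translates_E M C) [(y, 1)]"
    if "L = A @ (x, 0) # B" "A @ B \<noteq> []" for A x B
  proof -
    have "weighted_simplex (translates_E M C) (A @ B)"
      using less.prems(1) that
      by (intro weighted_simplex_subset[OF less.prems(1)]) (auto simp: weighted_simplex_def)
    then have "point_class (translates_E M C) (A @ B) = point_class (translates_E M C) [(y, 1)]"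
      using less.prems(2) that by (intro less.hyps) auto
    with glue_class_eq[OF glue_drop_zero] that less.prems(1) show ?thesis by metis
  qed
  consider "L = []" | x a where "L = [(x, a)]" | x a x' b L' where "L = (x, a) # (x', b) # L'"
    by (metis list.exhaust surj_pair)
  then show ?case
  proof cases
    case 1
    then show ?thesis using less.prems(1) by (simp add: weighted_simplex_def)
  next
    case 2
    then show ?thesis using less.prems by (auto simp: weighted_simplex_def)
  next
    case 3
    have nonneg: "0 \<le> a" "0 \<le> b" using less.prems(1) 3 by (auto simp: weighted_simplex_def)
    consider "a = 0" | "b = 0" | "0 < a" "0 < b" using nonneg by linarith
    then show ?thesis
    proof cases
      case 1
      then show ?thesis using red[of "[]" x "(x', b) # L'"] 3 by simp
    next
      case 2
      then show ?thesis using red[of "[(x, a)]" x' L'] 3 by simp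
    next
      case pos: 3
      have xy: "x = y" "x' = y" using less.prems(2) 3 pos by auto
      have "weighted_simplex (translates_E M C) ((y, a + b) # L')"
        using less.prems(1) xy 3 nonneg
        by (intro weighted_simplex_subset[OF less.prems(1)]) (auto simp: weighted_simplex_def)
      moreover from this have "point_class (translates_E M C) ((y, a + b) # L') =
          point_class (translates_E M C) [(y, 1)]"
        using less.prems(2) 3 by (intro less.hyps) auto
      ultimately show ?thesis
        using glue_class_eq[OF glue_merge[of M C "[]" y a b L']] xy 3 nonneg by simp
    qed
  qed
qed

section \<open>Maps out of the realization\<close>

lemma continuous_map_cells_coordinates:
  "continuous_map (cells X) (powertop_real UNIV) (\<lambda>P. snd (snd P))"
  unfolding continuous_map_def
proof (intro conjI allI impI)
  fix U :: "(nat \<Rightarrow> real) set"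
  assume U: "openin (powertop_real UNIV) U"
  define Y where "Y n = prod_topology (discrete_topology (simplices X n))
      (subtopology (powertop_real UNIV) (standard_simplex n))" for n
  have Y: "continuous_map (Y n) (powertop_real UNIV) snd" for n
    unfolding Y_def
    by (intro continuous_map_compose[OF continuous_map_snd, unfolded o_def]
        continuous_map_from_subtopology) auto
  have "{x. (n, x) \<in> {P \<in> topspace (cells X). snd (snd P) \<in> U}} = {x \<in> topspace (Y n). snd x \<in> U}" for n
    by (auto simp: cells_def Y_def)
  moreover have "openin (Y n) {x \<in> topspace (Y n). snd x \<in> U}" for n
    using openin_continuous_map_preimage[OF Y U] .
  ultimately show "openin (cells X) {P \<in> topspace (cells X). snd (snd P) \<in> U}"
    unfolding cells_def openin_sum_topology by (auto simp: Y_def)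
qed auto

lemma openin_cell:
  assumes "x \<in> simplices X n"
  shows "openin (cells X) ({n} \<times> {x} \<times> standard_simplex n)"
proof -
  have "{y. (m, y) \<in> {n} \<times> {x} \<times> standard_simplex n} =
      (if m = n then {x} \<times> standard_simplex n else {})" for m by auto
  moreover have "openin (subtopology (powertop_real UNIV) (standard_simplex n)) (standard_simplex n)"
    using openin_topspace[of "subtopology (powertop_real UNIV) (standard_simplex n)"] by simp
  ultimately show ?thesis
    using assms unfolding cells_def openin_sum_topology by (auto simp: openin_prod_Times_iff)
qed

lemma continuous_map_cell:
  assumes "x \<in> simplices X n"
  shows "continuous_map (subtopology (powertop_real UNIV) (standard_simplex n)) (cells X)
    (\<lambda>t. (n, x, t))"
proof -
  have "continuous_map (subtopology (powertop_real UNIV) (standard_simplex n))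
      (prod_topology (discrete_topology (simplices X n))
        (subtopology (powertop_real UNIV) (standard_simplex n))) (\<lambda>t. (x, t))"
    using assms by (simp add: continuous_map_pairedI)
  from continuous_map_compose[OF this
      continuous_map_component_injection[of n UNIV "\<lambda>n. prod_topology (discrete_topology (simplices X n))
        (subtopology (powertop_real UNIV) (standard_simplex n))"]]
  show ?thesis by (simp add: cells_def o_def)
qed

text \<open>The sets of points over a single simplex are open in the disjoint union, so continuity
  can be tested on one simplex at a time. The factor \<open>Z\<close> makes room for the parameter
  of a homotopy.\<close>

lemma continuous_map_prod_cells:
  assumes "\<And>n x. x \<in> simplices X n \<Longrightarrow>
    continuous_map (prod_topology Z (subtopology (powertop_real UNIV) (standard_simplex n))) Y
      (\<lambda>(z, t). f (z, n, x, t))"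
  shows "continuous_map (prod_topology Z (cells X)) Y f"
proof (rule pasting_lemma[where I = "{(n, x). x \<in> simplices X n}"
      and T = "\<lambda>(n, x). topspace Z \<times> ({n} \<times> {x} \<times> standard_simplex n)" and f = "\<lambda>_. f"])
  fix i assume "i \<in> {(n, x). x \<in> simplices X n}"
  then obtain n x where i: "i = (n, x)" and x: "x \<in> simplices X n" by auto
  show "openin (prod_topology Z (cells X))
      (case i of (n, x) \<Rightarrow> topspace Z \<times> ({n} \<times> {x} \<times> standard_simplex n))"
    by (simp add: i openin_prod_Times_iff openin_cell[OF x])
  let ?S = "subtopology (prod_topology Z (cells X)) (topspace Z \<times> ({n} \<times> {x} \<times> standard_simplex n))"
  have "continuous_map ?S (powertop_real UNIV) (\<lambda>p. snd (snd (snd p)))"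
    using continuous_map_compose[OF continuous_map_snd continuous_map_cells_coordinates, of Z X]
    by (intro continuous_map_from_subtopology) (simp add: o_def)
  moreover have "continuous_map ?S Z fst"
    by (intro continuous_map_from_subtopology continuous_map_fst)
  ultimately have "continuous_map ?S
      (prod_topology Z (subtopology (powertop_real UNIV) (standard_simplex n)))
      (\<lambda>p. (fst p, snd (snd (snd p))))"
    by (intro continuous_map_pairedI continuous_map_into_subtopology) (auto simp: topspace_subtopology)
  from continuous_map_compose[OF this assms[OF x]]
  have "continuous_map ?S Y (\<lambda>p. f (fst p, n, x, snd (snd (snd p))))"
    by (simp add: o_def)
  then have "continuous_map ?S Y f"
    by (rule continuous_map_eq) auto
  then show "continuous_map (subtopology (prod_topology Z (cells X))
      (case i of (n, x) \<Rightarrow> topspace Z \<times> ({n} \<times> {x} \<times> standard_simplex n))) Y f"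
    by (simp add: i)
next
  fix p assume "p \<in> topspace (prod_topology Z (cells X))"
  then show "\<exists>j. j \<in> {(n, x). x \<in> simplices X n} \<and>
      p \<in> (case j of (n, x) \<Rightarrow> topspace Z \<times> ({n} \<times> {x} \<times> standard_simplex n)) \<and> f p = f p"
    by (cases p) (auto simp: topspace_cells_iff)
qed auto

lemma continuous_map_powertop_coordinate:
  "continuous_map (prod_topology Z (subtopology (powertop_real UNIV) S)) euclideanreal (\<lambda>p. snd p i)"
proof -
  have "continuous_map (subtopology (powertop_real UNIV) S) euclideanreal (\<lambda>t. t i)"
    by (intro continuous_map_from_subtopology continuous_map_product_projection) simp
  from continuous_map_compose[OF continuous_map_snd this, of Z] show ?thesis by (simp add: o_def)
qed

lemma realization_lift:
  assumes cont: "continuous_map (cells X) Y h" and inv: "\<And>P Q. glue X P Q \<Longrightarrow> h P = h Q"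
  obtains g where "continuous_map (realization X) Y g"
    "\<And>P. P \<in> topspace (cells X) \<Longrightarrow> g (glue_rel X `` {P}) = h P"
proof (rule quotient_map_lift_exists[OF quotient_map_realization cont])
  show "h P = h Q" if "glue_rel X `` {P} = glue_rel X `` {Q}" for P Q
    using glue_invariant[where f = h, OF that inv] .
next
  fix g
  assume "continuous_map (realization X) Y g"
    "\<And>P. P \<in> topspace (cells X) \<Longrightarrow> g (glue_rel X `` {P}) = h P"
  then show thesis by (rule that)
qed

section \<open>Compact sets have finite support\<close>

text \<open>A function that is affine on each cell and respects the gluings is continuous on the
  realization, however fast its values at vertices grow. With infinitely many vertices in the
  support, such a function could be unbounded on a compact set.\<close>

lemma compact_finite_support:
  assumes Q: "compactin (realization (translates_E M C)) Q"
  shows "finite {v. \<exists>P a. P \<in> topspace (cells (translates_E M C)) \<and>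
    glue_rel (translates_E M C) `` {P} \<in> Q \<and> (v, a) \<in> set (weights P) \<and> 0 < a}"
    (is "finite ?V")
proof (rule ccontr)
  let ?X = "translates_E M C"
  assume inf: "infinite ?V"
  obtain v :: "nat \<Rightarrow> 'a" where v': "inj v \<and> range v \<subseteq> ?V"
    using infinite_countable_subset[OF inf] ..
  then have inj: "inj v" and v: "range v \<subseteq> ?V" by (rule conjunct1, rule conjunct2)
  have "\<exists>P a. P \<in> topspace (cells ?X) \<and> glue_rel ?X `` {P} \<in> Q \<and> (v j, a) \<in> set (weights P) \<and> 0 < a" for j
    using subsetD[OF v rangeI[of v j]] unfolding mem_Collect_eq .
  then obtain P a where P: "\<And>j. P j \<in> topspace (cells ?X)" "\<And>j. glue_rel ?X `` {P j} \<in> Q"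
    and a: "\<And>j. (v j, a j) \<in> set (weights (P j))" "\<And>j. 0 < a j"
    by metis
  \<comment> \<open>Dividing by the barycentric coordinate \<open>a j\<close> makes the contribution
    of \<open>v j\<close> at \<open>P j\<close> equal to \<open>j\<close>.\<close>
  define w where "w x = (if x \<in> range v then real (inv_into UNIV v x) / a (inv_into UNIV v x) else 0)" for x
  have w0: "0 \<le> w x" for x using a(2) by (simp add: w_def less_imp_le)
  \<comment> \<open>The weights are chosen such that this function is unbounded on \<open>Q\<close>.\<close>
  define \<Phi> where "\<Phi> R = (\<Sum>(x, b)\<leftarrow>weights R. b * w x)" for R
  have inv\<Phi>: "\<Phi> R = \<Phi> R'" if "glue ?X R R'" for R R'
    using that by (cases rule: glue_weights_cases) (simp_all add: \<Phi>_def algebra_simps)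
  \<comment> \<open>A one-point parameter space specializes the cellwise criterion to maps without
    parameter.\<close>
  have "continuous_map (prod_topology (discrete_topology {()}) (cells ?X)) euclideanreal (\<Phi> \<circ> snd)"
  proof (rule continuous_map_prod_cells)
    fix n xs assume "xs \<in> simplices ?X n"
    then have len: "length xs = Suc n" by (simp add: simplices_translates)
    have "\<Phi> (n, xs, t) = (\<Sum>i\<le>n. t i * w (xs ! i))" for t
    proof -
      have "\<Phi> (n, xs, t) = (\<Sum>i<Suc n. t i * w (xs ! i))"
        unfolding \<Phi>_def weights_def sum_list_sum_nth
        using len by (auto intro!: sum.cong simp: atLeast0LessThan simp del: upt_Suc)
      then show ?thesis by (simp add: lessThan_Suc_atMost)
    qed
    then have eq: "(\<lambda>(z :: unit, t). (\<Phi> \<circ> snd) (z, n, xs, t)) = (\<lambda>p. \<Sum>i\<le>n. snd p i * w (xs ! i))"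
      by (simp add: split_def)
    show "continuous_map (prod_topology (discrete_topology {()})
        (subtopology (powertop_real UNIV) (standard_simplex n))) euclideanreal
        (\<lambda>(z, t). (\<Phi> \<circ> snd) (z, n, xs, t))"
      unfolding eq
      by (intro continuous_map_sum continuous_map_real_mult continuous_map_powertop_coordinate) auto
  qed
  moreover have "continuous_map (cells ?X) (prod_topology (discrete_topology {()}) (cells ?X)) (Pair ())"
    by (simp add: continuous_map_pairedI)
  ultimately have "continuous_map (cells ?X) euclideanreal ((\<Phi> \<circ> snd) \<circ> Pair ())"
    by (rule continuous_map_compose[rotated])
  then have cont: "continuous_map (cells ?X) euclideanreal \<Phi>" by (simp add: o_def)
  obtain \<phi> where \<phi>: "continuous_map (realization ?X) euclideanreal \<phi>"
    "\<And>R. R \<in> topspace (cells ?X) \<Longrightarrow> \<phi> (glue_rel ?X `` {R}) = \<Phi> R"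
    using realization_lift[OF cont inv\<Phi>] by metis
  have "bounded (\<phi> ` Q)"
    using image_compactin[OF Q \<phi>(1)] by (simp add: compact_imp_bounded)
  then obtain B where B: "\<And>y. y \<in> \<phi> ` Q \<Longrightarrow> \<bar>y\<bar> \<le> B"
    by (auto simp: bounded_iff)
  obtain j :: nat where j: "B < real j" using reals_Archimedean2 by blast
  have nonneg: "0 \<le> b" if "(x, b) \<in> set (weights (P j))" for x b
    using weights_cells(1)[OF P(1)] that by (force simp: weighted_simplex_def)
  have "a j * w (v j) \<le> \<Phi> (P j)"
    unfolding \<Phi>_def
  proof (rule member_le_sum_list)
    show "a j * w (v j) \<in> set (map (\<lambda>(x, b). b * w x) (weights (P j)))"
      using a(1)[of j] by force
    show "0 \<le> y" if "y \<in> set (map (\<lambda>(x, b). b * w x) (weights (P j)))" for y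
      using that nonneg w0 by auto
  qed
  moreover have "a j * w (v j) = real j"
    using a(2)[of j] inj by (simp add: w_def inv_f_f)
  moreover have "\<Phi> (P j) \<le> B"
    using B[of "\<Phi> (P j)"] \<phi>(2)[OF P(1), of j] P(2)[of j] by (metis abs_le_D1 imageI)
  ultimately show False using j by simp
qed

section \<open>Homotopies induced by vertex maps\<close>

definition map_cell :: "('a \<Rightarrow> 'b) \<Rightarrow> nat \<times> 'a list \<times> (nat \<Rightarrow> real) \<Rightarrow> nat \<times> 'b list \<times> (nat \<Rightarrow> real)" where
  "map_cell p = (\<lambda>(n, xs, t). (n, map p xs, t))"

text \<open>Formed from whole classes like \<open>realization_incl\<close>, which is the case
  \<open>id\<close>, so that no representative has to be chosen.\<close>

definition vertex_map ::
  "'b list sset \<Rightarrow> ('a \<Rightarrow> 'b) \<Rightarrow> (nat \<times> 'a list \<times> (nat \<Rightarrow> real)) set \<Rightarrow> (nat \<times> 'b list \<times> (nat \<Rightarrow> real)) set"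
  where "vertex_map Y p c = glue_rel Y `` (map_cell p ` c)"

lemma map_cell_id [simp]: "map_cell id = id"
  by (auto simp: map_cell_def)

lemma vertex_map_id: "vertex_map Y id = realization_incl Y"
  by (simp add: vertex_map_def realization_incl_def fun_eq_iff)

lemma weights_map_cell: "weights (map_cell p P) = map (map_prod p id) (weights P)"
  by (cases P) (auto simp: weights_def map_cell_def zip_map1 map_prod_def)

lemma glue_map_cell:
  assumes p: "\<And>n xs. xs \<in> simplices (translates_E M C) n \<Longrightarrow> map p xs \<in> simplices (translates_E N D) n"
    and "glue (translates_E M C) P Q"
  shows "glue (translates_E N D) (map_cell p P) (map_cell p Q)"
  using assms(2)
proof cases
  case (glue_face xs n i t)
  have "map p (face (translates_E M C) (Suc n) i xs) = face (translates_E N D) (Suc n) i (map p xs)"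
    by (simp add: face_translates take_map drop_map)
  then show ?thesis
    using glue.glue_face[OF p[OF glue_face(3)] glue_face(4,5)] glue_face(1,2) by (simp add: map_cell_def)
next
  case (glue_degen xs n i t)
  have "map p (degen (translates_E M C) n i xs) = degen (translates_E N D) n i (map p xs)"
    by (simp add: degen_translates take_map drop_map)
  then show ?thesis
    using glue.glue_degen[OF p[OF glue_degen(3)] glue_degen(4,5)] glue_degen(1,2) by (simp add: map_cell_def)
qed

lemma vertex_map_class:
  assumes p: "\<And>n xs. xs \<in> simplices (translates_E M C) n \<Longrightarrow> map p xs \<in> simplices (translates_E N D) n"
  shows "vertex_map (translates_E N D) p (glue_rel (translates_E M C) `` {P}) =
    glue_rel (translates_E N D) `` {map_cell p P}"
proof -
  have *: "glue_rel (translates_E N D) `` {map_cell p P} = glue_rel (translates_E N D) `` {map_cell p Q}"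
    if "glue_rel (translates_E M C) `` {P} = glue_rel (translates_E M C) `` {Q}" for Q
    by (rule glue_invariant[where f = "\<lambda>Q. glue_rel (translates_E N D) `` {map_cell p Q}", OF that])
      (intro glue_class_eq glue_map_cell[OF p])
  show ?thesis
  proof (intro equalityI subsetI)
    fix R assume "R \<in> vertex_map (translates_E N D) p (glue_rel (translates_E M C) `` {P})"
    then obtain Q where "(P, Q) \<in> glue_rel (translates_E M C)" "R \<in> glue_rel (translates_E N D) `` {map_cell p Q}"
      by (auto simp: vertex_map_def)
    then show "R \<in> glue_rel (translates_E N D) `` {map_cell p P}"
      using *[of Q] glue_rel_eq_iff[of "translates_E M C" P Q] by (simp add: glue_rel_def)
  next
    fix R assume "R \<in> glue_rel (translates_E N D) `` {map_cell p P}"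
    moreover have "P \<in> glue_rel (translates_E M C) `` {P}" by (simp add: glue_rel_def)
    ultimately show "R \<in> vertex_map (translates_E N D) p (glue_rel (translates_E M C) `` {P})"
      unfolding vertex_map_def by blast
  qed
qed

lemma simplicial_codegen_in_standard_simplex:
  assumes t: "t \<in> standard_simplex (Suc n)" and i: "i \<le> n"
  shows "simplicial_codegen i t \<in> standard_simplex n"
proof -
  have sum: "(\<Sum>j\<le>n. simplicial_codegen i t j) = (\<Sum>j\<le>Suc n. t j)"
    using i
  proof (induction n rule: nat_induct_at_least)
    case base
    have "(\<Sum>j<i. simplicial_codegen i t j) = (\<Sum>j<i. t j)"
      by (simp add: simplicial_codegen_def)
    then show ?case
      by (simp add: simplicial_codegen_def flip: lessThan_Suc_atMost)
  next
    case (Suc n)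
    then show ?case by (simp add: simplicial_codegen_def)
  qed
  have nonneg: "0 \<le> simplicial_codegen i t j" for j
    using t by (simp add: simplicial_codegen_def standard_simplex_def)
  moreover have zero: "simplicial_codegen i t j = 0" if "j > n" for j
    using t i that by (simp add: simplicial_codegen_def standard_simplex_def)
  moreover have "simplicial_codegen i t j \<le> 1" for j
  proof (cases "j \<le> n")
    case True
    then have "simplicial_codegen i t j \<le> (\<Sum>j\<le>n. simplicial_codegen i t j)"
      using nonneg by (intro member_le_sum) auto
    also have "\<dots> = 1" unfolding sum using t unfolding standard_simplex_def by blast
    finally show ?thesis .
  qed (simp add: zero)
  moreover have "(\<Sum>j\<le>n. simplicial_codegen i t j) = 1"
    unfolding sum using t unfolding standard_simplex_def by blast
  ultimately show ?thesis unfolding standard_simplex_def by blast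
qed

lemma glue_target_in_cells:
  assumes "glue X P Q"
  shows "Q \<in> topspace (cells X)"
  using assms
proof cases
  case (glue_face x n i t)
  then show ?thesis
    using simplical_face_in_standard_simplex[of "Suc n" i t] by (simp add: topspace_cells_iff)
next
  case (glue_degen x n i t)
  then show ?thesis
    using simplicial_codegen_in_standard_simplex by (simp add: topspace_cells_iff)
qed

lemma point_class_drop_zeros:
  assumes "weighted_simplex (translates_E M C) (A @ Z @ B)" "A @ B \<noteq> []" "\<And>z. z \<in> set Z \<Longrightarrow> snd z = 0"
  shows "point_class (translates_E M C) (A @ Z @ B) = point_class (translates_E M C) (A @ B)"
  using assms
proof (induction Z)
  case (Cons z Z)
  obtain x where z: "z = (x, 0)" using Cons.prems(3)[of z] by (cases z) auto
  have "point_class (translates_E M C) (A @ Z @ B) = point_class (translates_E M C) (A @ (x, 0) # Z @ B)"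
    using Cons.prems z by (intro glue_class_eq glue_drop_zero) auto
  moreover have "weighted_simplex (translates_E M C) (A @ Z @ B)"
    using Cons.prems z
    by (intro weighted_simplex_subset[OF Cons.prems(1)]) (auto simp: weighted_simplex_def)
  ultimately show ?case using Cons z by simp
qed simp

section \<open>Straight-line homotopies in joins\<close>

text \<open>The two images are concatenated, and not interleaved, so that the homotopy is compatible
  with degeneracies.\<close>

definition join_weights :: "('a \<Rightarrow> 'b) \<Rightarrow> ('a \<Rightarrow> 'b) \<Rightarrow> real \<Rightarrow> ('a \<times> real) list \<Rightarrow> ('b \<times> real) list" where
  "join_weights p q s L = map (\<lambda>(x, a). (p x, (1 - s) * a)) L @ map (\<lambda>(x, a). (q x, s * a)) L"

lemma map_fst_join_weights:
  "map fst (join_weights p q s L) = map p (map fst L) @ map q (map fst L)"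
  by (simp add: join_weights_def split_def o_def)

lemma weighted_simplex_join:
  assumes step: "homotopy_step \<xi> C D p q" and s: "0 \<le> s" "s \<le> 1"
    and L: "weighted_simplex (translates_E (halfspace \<xi>) C) L"
  shows "weighted_simplex (translates_E (halfspace \<xi>) D) (join_weights p q s L)"
  unfolding weighted_simplex_def
proof (intro conjI)
  obtain g where g: "g \<in> halfspace \<xi>" "\<And>x. x \<in> set (map fst L) \<Longrightarrow> \<exists>y\<in>C. x = g + y"
    using L unfolding weighted_simplex_def simplices_translates by blast
  have pg: "p g \<in> halfspace \<xi>"
    and D: "\<And>y. y \<in> C \<Longrightarrow> \<exists>a\<in>D. \<exists>b\<in>D. p (g + y) = p g + a \<and> q (g + y) = p g + b"
    using step g(1) unfolding homotopy_step_def by blast+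
  have "\<exists>b\<in>D. z = p g + b" if z: "z \<in> set (map fst (join_weights p q s L))" for z
  proof -
    obtain x where x: "x \<in> set (map fst L)" "z = p x \<or> z = q x"
      using z unfolding map_fst_join_weights by auto
    obtain y where y: "y \<in> C" "x = g + y" using g(2)[OF x(1)] by blast
    show ?thesis using D[OF y(1)] x(2) y(2) by metis
  qed
  moreover have "length (map fst (join_weights p q s L)) = Suc (length (join_weights p q s L) - 1)"
    using L by (cases L) (auto simp: join_weights_def weighted_simplex_def)
  ultimately show "map fst (join_weights p q s L) \<in>
      simplices (translates_E (halfspace \<xi>) D) (length (join_weights p q s L) - 1)"
    unfolding simplices_translates using pg by blast
  show "join_weights p q s L \<noteq> []" using L by (auto simp: join_weights_def weighted_simplex_def)
  show "\<forall>a\<in>set (join_weights p q s L). 0 \<le> snd a"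
    using L s by (auto simp: join_weights_def weighted_simplex_def)
  have "sum_list (map snd (join_weights p q s L)) =
      (1 - s) * sum_list (map snd L) + s * sum_list (map snd L)"
    by (simp add: join_weights_def split_def o_def sum_list_const_mult)
  then show "sum_list (map snd (join_weights p q s L)) = 1"
    using L by (simp add: weighted_simplex_def)
qed

text \<open>A gluing of \<open>P\<close> and \<open>Q\<close> shows up twice in the join, once in
  each half, and the two occurrences are treated one after the other.\<close>

lemma point_class_join_invariant:
  assumes step: "homotopy_step \<xi> C D p q" and s: "0 \<le> s" "s \<le> 1"
    and glue: "glue (translates_E (halfspace \<xi>) C) P Q"
  shows "point_class (translates_E (halfspace \<xi>) D) (join_weights p q s (weights P)) =
    point_class (translates_E (halfspace \<xi>) D) (join_weights p q s (weights Q))"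
proof -
  let ?Y = "translates_E (halfspace \<xi>) D"
  have Q: "weighted_simplex ?Y (join_weights p q s (weights Q))"
    by (rule weighted_simplex_join[OF step s weights_cells(1)[OF glue_target_in_cells[OF glue]]])
  let ?p = "map (\<lambda>(x, a). (p x, (1 - s) * a))" and ?q = "map (\<lambda>(x, a). (q x, s * a))"
  from glue show ?thesis
  proof (cases rule: glue_weights_cases)
    case (drop_zero A B x)
    have jQ: "join_weights p q s (weights Q) = ?p A @ [(p x, 0)] @ (?p B @ ?q A @ (q x, 0) # ?q B)"
      by (simp add: drop_zero join_weights_def)
    have 1: "weighted_simplex ?Y ((?p A @ ?p B @ ?q A) @ [(q x, 0)] @ ?q B)"
      using Q unfolding jQ
      by (intro weighted_simplex_subset[OF Q[unfolded jQ]]) (auto simp: weighted_simplex_def)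
    have "point_class ?Y (join_weights p q s (weights Q)) =
        point_class ?Y ((?p A @ ?p B @ ?q A) @ [(q x, 0)] @ ?q B)"
      using point_class_drop_zeros[OF Q[unfolded jQ]] by (simp add: jQ)
    also have "\<dots> = point_class ?Y ((?p A @ ?p B @ ?q A) @ ?q B)"
      using drop_zero(3) by (intro point_class_drop_zeros[OF 1]) auto
    finally show ?thesis by (simp add: drop_zero join_weights_def)
  next
    case (merge A B x a b)
    have jQ: "join_weights p q s (weights Q) =
        (?p A @ (p x, (1 - s) * a + (1 - s) * b) # ?p B @ ?q A) @ (q x, s * a + s * b) # ?q B"
      by (simp add: merge join_weights_def ring_distribs)
    define K where "K = ?p B @ ?q A @ (q x, s * a) # (q x, s * b) # ?q B"
    have nonneg: "0 \<le> (1 - s) * a" "0 \<le> (1 - s) * b" "0 \<le> s * a" "0 \<le> s * b"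
      using s merge by auto
    have 1: "weighted_simplex ?Y (?p A @ (p x, (1 - s) * a + (1 - s) * b) # K)"
      using Q unfolding jQ K_def
      by (intro weighted_simplex_subset[OF Q[unfolded jQ]]) (use nonneg in \<open>auto simp: weighted_simplex_def\<close>)
    have "point_class ?Y (join_weights p q s (weights Q)) =
        point_class ?Y (?p A @ (p x, (1 - s) * a + (1 - s) * b) # K)"
      using glue_class_eq[OF glue_merge[OF Q[unfolded jQ] nonneg(3,4)]] by (simp add: jQ K_def)
    also have "\<dots> = point_class ?Y (?p A @ (p x, (1 - s) * a) # (p x, (1 - s) * b) # K)"
      using glue_class_eq[OF glue_merge[OF 1 nonneg(1,2)]] by simp
    also have "?p A @ (p x, (1 - s) * a) # (p x, (1 - s) * b) # K = join_weights p q s (weights P)"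
      by (simp add: merge join_weights_def K_def)
    finally show ?thesis ..
  qed
qed

lemma homotopy_step_simplices:
  assumes "homotopy_step \<xi> C D p q" "xs \<in> simplices (translates_E (halfspace \<xi>) C) n"
  shows "map p xs \<in> simplices (translates_E (halfspace \<xi>) D) n"
    "map q xs \<in> simplices (translates_E (halfspace \<xi>) D) n"
proof -
  obtain g where g: "length xs = Suc n" "g \<in> halfspace \<xi>" "\<And>x. x \<in> set xs \<Longrightarrow> \<exists>y\<in>C. x = g + y"
    using assms(2) unfolding simplices_translates by blast
  have "p g \<in> halfspace \<xi>" "\<And>x. x \<in> set xs \<Longrightarrow> \<exists>a\<in>D. \<exists>b\<in>D. p x = p g + a \<and> q x = p g + b"
    using assms(1) g unfolding homotopy_step_def by blast+
  then show "map p xs \<in> simplices (translates_E (halfspace \<xi>) D) n"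
    "map q xs \<in> simplices (translates_E (halfspace \<xi>) D) n"
    using g(1) unfolding simplices_translates by fastforce+
qed

text \<open>At each end of the parameter interval one half of the join has weight 0 throughout and
  can be deleted.\<close>

lemma vertex_map_eq_join:
  assumes step: "homotopy_step \<xi> C D p q"
    and P: "P \<in> topspace (cells (translates_E (halfspace \<xi>) C))"
  shows "vertex_map (translates_E (halfspace \<xi>) D) p (glue_rel (translates_E (halfspace \<xi>) C) `` {P}) =
      point_class (translates_E (halfspace \<xi>) D) (join_weights p q 0 (weights P))"
    and "vertex_map (translates_E (halfspace \<xi>) D) q (glue_rel (translates_E (halfspace \<xi>) C) `` {P}) =
      point_class (translates_E (halfspace \<xi>) D) (join_weights p q 1 (weights P))"
proof -
  let ?X = "translates_E (halfspace \<xi>) C" and ?Y = "translates_E (halfspace \<xi>) D"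
  have join: "weighted_simplex ?Y (join_weights p q s (weights P))" if "0 \<le> s" "s \<le> 1" for s
    by (rule weighted_simplex_join[OF step that weights_cells(1)[OF P]])
  have nonempty: "weights P \<noteq> []" using weights_cells(1)[OF P] by (simp add: weighted_simplex_def)
  have map: "point (map (map_prod r id) (weights P)) = map_cell r P"
    if "\<And>n xs. xs \<in> simplices ?X n \<Longrightarrow> map r xs \<in> simplices ?Y n" for r
  proof -
    have "map_cell r P \<in> topspace (cells ?Y)"
      using P that by (cases P) (auto simp: map_cell_def topspace_cells_iff)
    from weights_cells(2)[OF this] show ?thesis by (simp add: weights_map_cell)
  qed
  have "join_weights p q 0 (weights P) = map (map_prod p id) (weights P) @ map (\<lambda>(x, a). (q x, 0)) (weights P) @ []"
    by (auto simp: join_weights_def)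
  then have "point_class ?Y (join_weights p q 0 (weights P)) =
      point_class ?Y (map (map_prod p id) (weights P) @ [])"
    using join[of 0] nonempty by (simp only:) (rule point_class_drop_zeros; auto)
  then show "vertex_map ?Y p (glue_rel ?X `` {P}) = point_class ?Y (join_weights p q 0 (weights P))"
    using vertex_map_class[OF homotopy_step_simplices(1)[OF step]] map[OF homotopy_step_simplices(1)[OF step]]
    by simp
  have "join_weights p q 1 (weights P) = [] @ map (\<lambda>(x, a). (p x, 0)) (weights P) @ map (map_prod q id) (weights P)"
    by (auto simp: join_weights_def)
  then have "point_class ?Y (join_weights p q 1 (weights P)) =
      point_class ?Y ([] @ map (map_prod q id) (weights P))"
    using join[of 1] nonempty by (simp only:) (rule point_class_drop_zeros; auto)
  then show "vertex_map ?Y q (glue_rel ?X `` {P}) = point_class ?Y (join_weights p q 1 (weights P))"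
    using vertex_map_class[OF homotopy_step_simplices(2)[OF step]] map[OF homotopy_step_simplices(2)[OF step]]
    by simp
qed

lemma continuous_map_join:
  assumes step: "homotopy_step \<xi> C D p q"
  shows "continuous_map (prod_topology (top_of_set {0..1}) (cells (translates_E (halfspace \<xi>) C)))
    (realization (translates_E (halfspace \<xi>) D))
    (\<lambda>(s, P). point_class (translates_E (halfspace \<xi>) D) (join_weights p q s (weights P)))"
proof (rule continuous_map_prod_cells)
  let ?X = "translates_E (halfspace \<xi>) C" and ?Y = "translates_E (halfspace \<xi>) D"
  fix n xs assume xs: "xs \<in> simplices ?X n"
  let ?Z = "prod_topology (top_of_set {0..1::real}) (subtopology (powertop_real UNIV) (standard_simplex n))"
  \<comment> \<open>Two lists of n + 1 vertices each span a cell of dimension 2n + 1. On it the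
    barycentric coordinates \<open>W\<close> are polynomial in the parameter and the coordinates of
    the source.\<close>
  define m where "m = Suc (2 * n)"
  define ys where "ys = map p xs @ map q xs"
  define W :: "real \<times> (nat \<Rightarrow> real) \<Rightarrow> nat \<Rightarrow> real" where
    "W = (\<lambda>(s, t) i. if i < Suc n then (1 - s) * t i else if i < Suc m then s * t (i - Suc n) else 0)"
  have len: "length xs = Suc n" using xs by (simp add: simplices_translates)
  have point: "point (join_weights p q s (weights (n, xs, t))) = (m, ys, W (s, t))" for s t
  proof -
    have "length (weights (n, xs, t)) = Suc n" "map fst (weights (n, xs, t)) = xs"
      using len by (simp_all add: weights_def)
    then have "length (join_weights p q s (weights (n, xs, t))) = Suc m"
      "map fst (join_weights p q s (weights (n, xs, t))) = ys"
      by (simp_all only: map_fst_join_weights ys_def) (simp add: join_weights_def m_def)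
    moreover have "(if i < Suc m then snd (join_weights p q s (weights (n, xs, t)) ! i) else 0) = W (s, t) i" for i
      using len by (auto simp: join_weights_def W_def weights_def nth_append m_def simp del: upt_Suc)
    ultimately show ?thesis by (simp add: point_def)
  qed
  have in_cells: "(m, ys, W (s, t)) \<in> topspace (cells ?Y)"
    if "s \<in> {0..1}" "t \<in> standard_simplex n" for s t
  proof -
    have "(n, xs, t) \<in> topspace (cells ?X)" using xs that by (simp add: topspace_cells_iff)
    from point_in_cells[OF weighted_simplex_join[OF step _ _ weights_cells(1)[OF this]], of s]
    show ?thesis using that point by simp
  qed
  have ys: "ys \<in> simplices ?Y m"
    using in_cells[of 0] nonempty_standard_simplex[of n] by (auto simp: topspace_cells_iff)
  have fst: "continuous_map ?Z euclideanreal fst"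
    using continuous_map_compose[OF continuous_map_fst continuous_map_from_subtopology[OF continuous_map_id]]
    by (fastforce simp: o_def id_def)
  have "continuous_map ?Z euclideanreal (\<lambda>z. W z i)" for i
  proof -
    consider "i < Suc n" | "\<not> i < Suc n" "i < Suc m" | "\<not> i < Suc m" "\<not> i < Suc n" by (auto simp: m_def)
    then show ?thesis
      by cases (auto simp: W_def split_def intro!: continuous_map_real_mult continuous_map_diff fst
          continuous_map_powertop_coordinate)
  qed
  then have "continuous_map ?Z (powertop_real UNIV) W"
    unfolding continuous_map_componentwise_UNIV by blast
  then have "continuous_map ?Z (subtopology (powertop_real UNIV) (standard_simplex m)) W"
    using in_cells by (auto simp: continuous_map_in_subtopology topspace_cells_iff)
  from continuous_map_compose[OF continuous_map_compose[OF this continuous_map_cell[OF ys]]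
      quotient_imp_continuous_map[OF quotient_map_realization]]
  show "continuous_map ?Z (realization ?Y)
      (\<lambda>(s, t). case (s, n, xs, t) of (s, P) \<Rightarrow> point_class ?Y (join_weights p q s (weights P)))"
    by (simp add: o_def point split_def)
qed

lemma homotopy_step_homotopic:
  assumes step: "homotopy_step \<xi> C D p q"
  shows "homotopic_with (\<lambda>_. True)
    (realization (translates_E (halfspace \<xi>) C)) (realization (translates_E (halfspace \<xi>) D))
    (vertex_map (translates_E (halfspace \<xi>) D) p) (vertex_map (translates_E (halfspace \<xi>) D) q)"
proof -
  let ?X = "translates_E (halfspace \<xi>) C" and ?Y = "translates_E (halfspace \<xi>) D"
  let ?I = "top_of_set {0..1::real}"
  define J where "J = (\<lambda>(s, P). point_class ?Y (join_weights p q s (weights P)))"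
  \<comment> \<open>The product of a quotient map with a locally compact Hausdorff space is again a
    quotient map; hence the homotopy may be defined on cells and then descends.\<close>
  have quot: "quotient_map (prod_topology ?I (cells ?X)) (prod_topology ?I (realization ?X))
      (\<lambda>(s, P). (s, glue_rel ?X `` {P}))"
  proof (rule quotient_map_prod_right[OF _ _ quotient_map_realization])
    show "locally_compact_space ?I"
      by (simp add: compact_imp_locally_compact_space compact_space_subtopology)
    show "Hausdorff_space ?I \<or> regular_space ?I"
      by (simp add: Hausdorff_space_subtopology)
  qed
  have J: "continuous_map (prod_topology ?I (cells ?X)) (realization ?Y) J"
    unfolding J_def by (rule continuous_map_join[OF step])
  obtain H where H: "continuous_map (prod_topology ?I (realization ?X)) (realization ?Y) H"
    and HJ: "\<And>z. z \<in> topspace (prod_topology ?I (cells ?X)) \<Longrightarrow>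
      H (case z of (s, P) \<Rightarrow> (s, glue_rel ?X `` {P})) = J z"
  proof (rule quotient_map_lift_exists[OF quot J])
    fix z z'
    assume z: "z \<in> topspace (prod_topology ?I (cells ?X))" "z' \<in> topspace (prod_topology ?I (cells ?X))"
      and eq: "(case z of (s, P) \<Rightarrow> (s, glue_rel ?X `` {P})) = (case z' of (s, P) \<Rightarrow> (s, glue_rel ?X `` {P}))"
    obtain s P s' P' where zs: "z = (s, P)" "z' = (s', P')" by (cases z, cases z') auto
    have s: "s' = s" "0 \<le> s" "s \<le> 1" and P: "glue_rel ?X `` {P} = glue_rel ?X `` {P'}"
      using z eq by (auto simp: zs)
    have "J (s, P) = J (s, P')"
      by (rule glue_invariant[where f = "\<lambda>P. J (s, P)", OF P])
        (simp add: J_def point_class_join_invariant[OF step s(2,3)])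
    then show "J z = J z'" by (simp add: zs s(1))
  next
    fix H
    assume "continuous_map (prod_topology ?I (realization ?X)) (realization ?Y) H"
      "\<And>z. z \<in> topspace (prod_topology ?I (cells ?X)) \<Longrightarrow>
        H (case z of (s, P) \<Rightarrow> (s, glue_rel ?X `` {P})) = J z"
    then show thesis by (rule that)
  qed
  have "H (0, c) = vertex_map ?Y p c \<and> H (1, c) = vertex_map ?Y q c" if c_in: "c \<in> topspace (realization ?X)" for c
  proof -
    obtain P where P: "P \<in> topspace (cells ?X)" and c: "c = glue_rel ?X `` {P}"
      using c_in unfolding topspace_realization by (rule quotientE)
    show ?thesis
      using HJ[of "(0, P)"] HJ[of "(1, P)"] P vertex_map_eq_join[OF step P] by (simp add: J_def c)
  qed
  then show ?thesis
    using H by (subst homotopic_with) auto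
qed

section \<open>Free and based null-homotopies of spheres\<close>

text \<open>The sphere lives in an infinite product of lines, so its compactness comes from
  Tychonoff's theorem: it is closed in the cube of sequences with entries in [-1, 1].\<close>

lemma compact_space_nsphere: "compact_space (nsphere k)"
proof -
  let ?S = "{x. (\<Sum>i\<le>k. (x i)\<^sup>2) = 1 \<and> (\<forall>i>k. x i = (0::real))}"
  have "compactin (powertop_real UNIV) ?S"
  proof (rule closed_compactin)
    show "compactin (powertop_real UNIV) (UNIV \<rightarrow>\<^sub>E {-1..1})"
      by (simp add: compactin_PiE)
    show "?S \<subseteq> UNIV \<rightarrow>\<^sub>E {-1..1}"
    proof
      fix x :: "nat \<Rightarrow> real"
      assume x: "x \<in> ?S"
      have "x i \<in> {-1..1}" for i
      proof (cases "i \<le> k")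
        case True
        then have "(x i)\<^sup>2 \<le> (\<Sum>i\<le>k. (x i)\<^sup>2)" by (intro member_le_sum) auto
        then have "(x i)\<^sup>2 \<le> 1" using x by simp
        then have "\<bar>x i\<bar> \<le> 1" by (simp add: abs_square_le_1)
        then show ?thesis by (auto simp: abs_le_iff)
      next
        case False
        then show ?thesis using x by auto
      qed
      then show "x \<in> UNIV \<rightarrow>\<^sub>E {-1..1}" by auto
    qed
    have eq: "?S = {x \<in> topspace (powertop_real UNIV). (\<Sum>i\<le>k. (x i)\<^sup>2) \<in> {1}} \<inter>
        (\<Inter>i\<in>{k<..}. {x \<in> topspace (powertop_real UNIV). x i \<in> {0}})"
      by auto
    have "closedin (powertop_real UNIV) {x \<in> topspace (powertop_real UNIV). (\<Sum>i\<le>k. (x i)\<^sup>2) \<in> {1}}"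
      by (rule closedin_continuous_map_preimage[where Y = euclideanreal])
        (auto intro!: continuous_map_sum continuous_map_real_pow continuous_map_product_projection)
    moreover have "closedin (powertop_real UNIV) {x \<in> topspace (powertop_real UNIV). x i \<in> {0::real}}" for i
      by (rule closedin_continuous_map_preimage[where Y = euclideanreal])
        (auto intro!: continuous_map_product_projection)
    ultimately show "closedin (powertop_real UNIV) ?S"
      unfolding eq by (intro closedin_Int closedin_Inter) auto
  qed
  then show ?thesis unfolding nsphere by (rule compact_space_subtopology)
qed

text \<open>A free null-homotopy extends the map to the ball, in which the base point can be connected
  to every other point by a segment.\<close>

lemma nullhomotopic_sphere_based:
  assumes "homotopic_with (\<lambda>_. True) (nsphere k) Y f (\<lambda>_. c)"
  shows "homotopic_with (\<lambda>h. h sphere_basepoint = f sphere_basepoint) (nsphere k) Y f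
    (\<lambda>_. f sphere_basepoint)"
proof -
  let ?I = "top_of_set {0..1::real}"
  let ?b = sphere_basepoint
  obtain H where H: "continuous_map (prod_topology ?I (nsphere k)) Y H"
    and H0: "\<And>x. H (0, x) = f x" and H1: "\<And>x. H (1, x) = c"
    using assms unfolding homotopic_with_def by auto
  define B where "B = {y. (\<Sum>i\<le>k. (y i)\<^sup>2) \<le> 1 \<and> (\<forall>i>k. y i = (0::real))}"
  \<comment> \<open>Polar coordinates: the cylinder over the sphere is mapped onto the ball
    \<open>B\<close>, its end \<open>t = 1\<close> to the centre.\<close>
  define q :: "real \<times> (nat \<Rightarrow> real) \<Rightarrow> nat \<Rightarrow> real" where "q = (\<lambda>(t, x) i. (1 - t) * x i)"
  have sphere: "x \<in> topspace (nsphere k) \<longleftrightarrow> (\<Sum>i\<le>k. (x i)\<^sup>2) = 1 \<and> (\<forall>i>k. x i = 0)" for x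
    by (simp add: nsphere)
  have b: "?b \<in> topspace (nsphere k)"
    using in_topspace_nsphere by (simp add: sphere_basepoint_def)
  have q_norm: "(\<Sum>i\<le>k. (q (t, x) i)\<^sup>2) = (1 - t)\<^sup>2" if "x \<in> topspace (nsphere k)" for t x
    using that by (simp add: q_def sphere power_mult_distrib flip: sum_distrib_left)
  have q_image: "q ` topspace (prod_topology ?I (nsphere k)) = B"
  proof (intro equalityI subsetI)
    fix y assume "y \<in> q ` topspace (prod_topology ?I (nsphere k))"
    then obtain t x where t: "0 \<le> t" "t \<le> 1" and x: "x \<in> topspace (nsphere k)" and y: "y = q (t, x)"
      by auto
    have "(1 - t)\<^sup>2 \<le> 1" using t by (simp add: power_le_one)
    then show "y \<in> B" using q_norm[OF x] x by (simp add: B_def y) (simp add: q_def sphere)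
  next
    fix y assume y: "y \<in> B"
    define r where "r = sqrt (\<Sum>i\<le>k. (y i)\<^sup>2)"
    have r2: "r\<^sup>2 = (\<Sum>i\<le>k. (y i)\<^sup>2)" by (simp add: r_def sum_nonneg)
    have r: "0 \<le> r" "r \<le> 1" using y by (simp_all add: r_def B_def sum_nonneg)
    show "y \<in> q ` topspace (prod_topology ?I (nsphere k))"
    proof (cases "r = 0")
      case True
      then have "y i = 0" if "i \<le> k" for i
        using r2 that by (simp add: sum_nonneg_eq_0_iff)
      then have "y = q (1, ?b)" using y by (auto simp: q_def B_def fun_eq_iff) (metis not_le)
      then show ?thesis using b by (auto intro!: image_eqI)
    next
      case False
      define x where "x i = y i / r" for i
      have "(\<Sum>i\<le>k. (x i)\<^sup>2) = r\<^sup>2 / r\<^sup>2"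
        by (simp add: x_def power_divide r2 flip: sum_divide_distrib)
      also have "\<dots> = 1" using False by simp
      finally have "x \<in> topspace (nsphere k)" using y by (auto simp: sphere x_def B_def)
      moreover have "y = q (1 - r, x)" using False by (auto simp: q_def x_def)
      ultimately show ?thesis using r by (auto intro!: image_eqI)
    qed
  qed
  have I_fst: "continuous_map (prod_topology ?I Z) euclideanreal fst" for Z :: "(nat \<Rightarrow> real) topology"
    using continuous_map_compose[OF continuous_map_fst continuous_map_from_subtopology[OF continuous_map_id]]
    by (fastforce simp: o_def id_def)
  have S_snd: "continuous_map (prod_topology ?I (nsphere k)) euclideanreal (\<lambda>p. snd p i)" for i
    using continuous_map_compose[OF continuous_map_snd continuous_map_nsphere_projection[of k i], of ?I]
    by (simp add: o_def)
  have "continuous_map (prod_topology ?I (nsphere k)) (powertop_real UNIV) q"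
    unfolding continuous_map_componentwise_UNIV q_def split_def
    by (intro allI continuous_map_real_mult continuous_map_diff I_fst S_snd) auto
  then have q_cont: "continuous_map (prod_topology ?I (nsphere k)) (subtopology (powertop_real UNIV) B) q"
    using q_image by (auto simp: continuous_map_in_subtopology)
  have quot: "quotient_map (prod_topology ?I (nsphere k)) (subtopology (powertop_real UNIV) B) q"
  proof (rule T1_Spaces.continuous_imp_quotient_map[OF q_cont])
    show "compact_space (prod_topology ?I (nsphere k))"
      by (simp add: compact_space_prod_topology compact_space_nsphere compact_space_subtopology)
    show "Hausdorff_space (subtopology (powertop_real UNIV) B)"
      by (simp add: Hausdorff_space_subtopology Hausdorff_space_product_topology)
    show "q ` topspace (prod_topology ?I (nsphere k)) = topspace (subtopology (powertop_real UNIV) B)"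
      using q_image by simp
  qed
  \<comment> \<open>Distinct points with the same image under \<open>q\<close> lie on the end
    \<open>t = 1\<close>, where \<open>H\<close> is constant; so \<open>H\<close> factors through
    the ball.\<close>
  have H_eq: "H p = H p'" if p: "p \<in> topspace (prod_topology ?I (nsphere k))"
    "p' \<in> topspace (prod_topology ?I (nsphere k))" and eq: "q p = q p'" for p p'
  proof -
    obtain t x t' x' where px: "p = (t, x)" "p' = (t', x')" by (cases p, cases p') auto
    have t: "t \<le> 1" "t' \<le> 1" and x: "x \<in> topspace (nsphere k)" "x' \<in> topspace (nsphere k)"
      using p by (auto simp: px)
    have "(1 - t)\<^sup>2 = (1 - t')\<^sup>2"
      using q_norm[OF x(1), of t] q_norm[OF x(2), of t'] eq by (simp add: px)
    then have tt: "t = t'" using t by simp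
    show ?thesis
    proof (cases "t = 1")
      case False
      then have "x i = x' i" for i
        using fun_cong[OF eq, of i] by (simp add: px q_def tt)
      then have "x = x'" by (rule ext)
      then show ?thesis by (simp add: px tt)
    qed (simp add: px H1 flip: tt)
  qed
  obtain F where F: "continuous_map (subtopology (powertop_real UNIV) B) Y F"
    and FH: "\<And>p. p \<in> topspace (prod_topology ?I (nsphere k)) \<Longrightarrow> F (q p) = H p"
  proof (rule quotient_map_lift_exists[OF quot H])
    fix F
    assume "continuous_map (subtopology (powertop_real UNIV) B) Y F"
      "\<And>p. p \<in> topspace (prod_topology ?I (nsphere k)) \<Longrightarrow> F (q p) = H p"
    then show thesis by (rule that)
  qed (rule H_eq)
  have Ff: "F x = f x" if "x \<in> topspace (nsphere k)" for x
    using FH[of "(0, x)"] that by (simp add: H0 q_def)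
  \<comment> \<open>The segment from \<open>x\<close> to the base point. It stays in the ball
    because squares are convex, and it is constant for \<open>x\<close> the base point, so that
    \<open>F \<circ> K\<close> is a based homotopy.\<close>
  define K :: "real \<times> (nat \<Rightarrow> real) \<Rightarrow> nat \<Rightarrow> real"
    where "K = (\<lambda>(s, x) i. (1 - s) * x i + s * ?b i)"
  have "K (s, x) \<in> B" if s: "0 \<le> s" "s \<le> 1" and x: "x \<in> topspace (nsphere k)" for s x
  proof -
    have "(\<Sum>i\<le>k. (K (s, x) i)\<^sup>2) \<le> (\<Sum>i\<le>k. (1 - s) * (x i)\<^sup>2 + s * (?b i)\<^sup>2)"
    proof (rule sum_mono)
      fix i
      have "(1 - s) * (x i)\<^sup>2 + s * (?b i)\<^sup>2 - (K (s, x) i)\<^sup>2 = s * (1 - s) * (x i - ?b i)\<^sup>2"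
        by (simp add: K_def power2_eq_square algebra_simps)
      moreover have "0 \<le> s * (1 - s) * (x i - ?b i)\<^sup>2" using s by simp
      ultimately show "(K (s, x) i)\<^sup>2 \<le> (1 - s) * (x i)\<^sup>2 + s * (?b i)\<^sup>2" by linarith
    qed
    also have "\<dots> = 1" using x b by (simp add: sphere sum.distrib flip: sum_distrib_left)
    finally show ?thesis using x b by (simp add: B_def) (simp add: K_def sphere)
  qed
  moreover have "continuous_map (prod_topology ?I (nsphere k)) (powertop_real UNIV) K"
    unfolding continuous_map_componentwise_UNIV K_def split_def
    by (intro allI continuous_map_add continuous_map_real_mult continuous_map_diff I_fst S_snd) auto
  ultimately have "continuous_map (prod_topology ?I (nsphere k)) (subtopology (powertop_real UNIV) B) K"
    by (auto simp: continuous_map_in_subtopology)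
  from continuous_map_compose[OF this F]
  have FK: "continuous_map (prod_topology ?I (nsphere k)) Y (F \<circ> K)" .
  show ?thesis
  proof (subst homotopic_with)
    show "(h ?b = f ?b) = (g ?b = f ?b)" if "\<And>x. x \<in> topspace (nsphere k) \<Longrightarrow> h x = g x" for h g
      using that[OF b] by simp
    have "K (s, ?b) = ?b" for s by (auto simp: K_def algebra_simps)
    moreover have "K (0, x) = x" "K (1, x) = ?b" for x by (simp_all add: K_def)
    ultimately show "\<exists>h. continuous_map (prod_topology ?I (nsphere k)) Y h \<and>
        (\<forall>x\<in>topspace (nsphere k). h (0, x) = f x) \<and>
        (\<forall>x\<in>topspace (nsphere k). h (1, x) = f ?b) \<and>
        (\<forall>t\<in>{0..1}. h (t, ?b) = f ?b)"
      using FK Ff b by (intro exI[of _ "F \<circ> K"]) auto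
  qed
qed

section \<open>Essential connectedness\<close>

text \<open>All steps give homotopies between maps with the same source and target, so chains of any
  length concatenate without enlarging \<open>D\<close>.\<close>

lemma homotopy_steps_homotopic:
  assumes "(homotopy_step \<xi> C D)\<^sup>*\<^sup>* id q" "C \<subseteq> D"
  shows "homotopic_with (\<lambda>_. True)
    (realization (translates_E (halfspace \<xi>) C)) (realization (translates_E (halfspace \<xi>) D))
    (realization_incl (translates_E (halfspace \<xi>) D)) (vertex_map (translates_E (halfspace \<xi>) D) q)"
  using assms(1)
proof induction
  case base
  \<comment> \<open>This trivial step supplies reflexivity, and with it the continuity of the
    inclusion.\<close>
  have "homotopy_step \<xi> C D id id"
    using assms(2) unfolding homotopy_step_def by auto
  then show ?case using homotopy_step_homotopic by (metis vertex_map_id)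
next
  case (step p q)
  then show ?case using homotopic_with_trans homotopy_step_homotopic by blast
qed

lemma vertex_map_const:
  assumes q: "\<And>n xs. xs \<in> simplices (translates_E M C) n \<Longrightarrow> map q xs \<in> simplices (translates_E N D) n"
    and P: "P \<in> topspace (cells (translates_E M C))"
    and y: "\<And>x a. (x, a) \<in> set (weights P) \<Longrightarrow> 0 < a \<Longrightarrow> q x = y"
  shows "vertex_map (translates_E N D) q (glue_rel (translates_E M C) `` {P}) =
    point_class (translates_E N D) [(y, 1)]"
proof -
  have "map_cell q P \<in> topspace (cells (translates_E N D))"
    using P q by (cases P) (auto simp: map_cell_def topspace_cells_iff)
  note w = weights_cells[OF this]
  have "vertex_map (translates_E N D) q (glue_rel (translates_E M C) `` {P}) =
      point_class (translates_E N D) (weights (map_cell q P))"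
    using w(2) vertex_map_class[OF q, where P = P] by simp
  also have "\<dots> = point_class (translates_E N D) [(y, 1)]"
  proof (rule point_class_const[OF w(1)])
    fix x a assume "(x, a) \<in> set (weights (map_cell q P))" "0 < a"
    then show "x = y" using y by (auto simp: weights_map_cell)
  qed
  finally show ?thesis .
qed

text \<open>No induction: the last step alone sends simplices for \<open>C\<close> to simplices for
  \<open>D\<close>. Only for the empty chain does the inclusion of \<open>C\<close> in
  \<open>D\<close> take its place.\<close>

lemma homotopy_steps_simplices:
  assumes "(homotopy_step \<xi> C D)\<^sup>*\<^sup>* id q" "C \<subseteq> D"
    and "xs \<in> simplices (translates_E (halfspace \<xi>) C) n"
  shows "map q xs \<in> simplices (translates_E (halfspace \<xi>) D) n"
  using assms(1)
proof cases
  case rtrancl_refl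
  then have "map q xs = xs" by simp
  then show ?thesis using assms(2,3) unfolding simplices_translates by (metis subsetD)
next
  case (rtrancl_into_rtrancl p)
  then show ?thesis using homotopy_step_simplices(2) assms(3) by blast
qed

lemma sphere_map_null_homotopic:
  fixes C D :: "'g::topological_group_add set"
  assumes CD: "C \<subseteq> D"
    and contr: "\<And>V. finite V \<Longrightarrow> \<exists>q y. (homotopy_step \<xi> C D)\<^sup>*\<^sup>* id q \<and> (\<forall>v\<in>V. q v = y)"
    and f: "continuous_map (nsphere k) (realization (translates_E (halfspace \<xi>) C)) f"
  shows "\<exists>c. homotopic_with (\<lambda>_. True) (nsphere k) (realization (translates_E (halfspace \<xi>) D))
    (realization_incl (translates_E (halfspace \<xi>) D) \<circ> f) (\<lambda>_. c)"
proof -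
  let ?X = "translates_E (halfspace \<xi>) C" and ?Y = "translates_E (halfspace \<xi>) D"
  define V where "V = {v. \<exists>P a. P \<in> topspace (cells ?X) \<and>
    glue_rel ?X `` {P} \<in> f ` topspace (nsphere k) \<and> (v, a) \<in> set (weights P) \<and> 0 < a}"
  have "compactin (realization ?X) (f ` topspace (nsphere k))"
    using image_compactin[OF _ f] compact_space_nsphere[of k] by (simp add: compact_space_def)
  then have "finite V" unfolding V_def by (rule compact_finite_support)
  then obtain q y where q: "(homotopy_step \<xi> C D)\<^sup>*\<^sup>* id q" and y: "\<And>v. v \<in> V \<Longrightarrow> q v = y"
    using contr by blast
  have "homotopic_with (\<lambda>_. True) (nsphere k) (realization ?Y) (realization_incl ?Y \<circ> f) (vertex_map ?Y q \<circ> f)"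
    by (rule homotopic_with_compose_continuous_map_right[OF homotopy_steps_homotopic[OF q CD] f]) simp
  moreover have const: "(vertex_map ?Y q \<circ> f) x = point_class ?Y [(y, 1)]" if x: "x \<in> topspace (nsphere k)" for x
  proof -
    have fx: "f x \<in> topspace (cells ?X) // glue_rel ?X"
      using f x continuous_map_image_subset_topspace topspace_realization by blast
    obtain P where P: "P \<in> topspace (cells ?X)" and c: "f x = glue_rel ?X `` {P}"
      using fx by (rule quotientE)
    have "q v = y" if "(v, a) \<in> set (weights P)" "0 < a" for v a
    proof (rule y)
      have "glue_rel ?X `` {P} \<in> f ` topspace (nsphere k)" using x by (simp flip: c)
      then show "v \<in> V" unfolding V_def using P that by blast
    qed
    then show ?thesis
      using vertex_map_const[OF homotopy_steps_simplices[OF q CD] P] by (simp add: c)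
  qed
  moreover have "continuous_map (nsphere k) (realization ?Y) (vertex_map ?Y q \<circ> f)"
    using calculation(1) homotopic_with_imp_continuous_maps by blast
  then have "homotopic_with (\<lambda>_. True) (nsphere k) (realization ?Y) (vertex_map ?Y q \<circ> f)
      (\<lambda>_. point_class ?Y [(y, 1)])"
    using const by (intro homotopic_with_equal) auto
  ultimately show ?thesis using homotopic_with_trans by blast
qed

lemma based_homotopy_rel_Image_eq:
  assumes "(f, g) \<in> based_homotopy_rel k Y y"
  shows "based_homotopy_rel k Y y `` {f} = based_homotopy_rel k Y y `` {g}"
  using assms unfolding based_homotopy_rel_def
  by (auto intro: homotopic_with_trans homotopic_with_symD)

text \<open>The induced class is assembled from all representatives of \<open>c\<close>: each
  contributes the trivial class, and since there is at least one, the union is exactly that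
  class.\<close>

lemma homotopy_group_induced_trivial:
  assumes null: "\<And>f. f \<in> based_maps k X x \<Longrightarrow> (\<phi> \<circ> f, \<lambda>_. y) \<in> based_homotopy_rel k Y y"
    and c: "c \<in> homotopy_group k X x"
  shows "homotopy_group_induced k Y y \<phi> c = homotopy_group_trivial k Y y"
proof -
  obtain f where f: "f \<in> based_maps k X x" and c_eq: "c = based_homotopy_rel k X x `` {f}"
    using c unfolding homotopy_group_def by (rule quotientE)
  have "f \<in> c" using f by (simp add: c_eq based_homotopy_rel_def based_maps_def)
  have based: "h \<in> based_maps k X x" if "h \<in> c" for h
  proof -
    have *: "homotopic_with (\<lambda>h. h sphere_basepoint = x) (nsphere k) X f h"
      using that by (simp add: c_eq based_homotopy_rel_def)
    show ?thesis
      using homotopic_with_imp_continuous_maps[OF *] homotopic_with_imp_property[OF *]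
      by (simp add: based_maps_def)
  qed
  have "based_homotopy_rel k Y y `` {\<phi> \<circ> h} = based_homotopy_rel k Y y `` {\<lambda>_. y}" if "h \<in> c" for h
    by (rule based_homotopy_rel_Image_eq[OF null[OF based[OF that]]])
  then have "(\<Union>h\<in>c. based_homotopy_rel k Y y `` {\<phi> \<circ> h}) = based_homotopy_rel k Y y `` {\<lambda>_. y}"
    using \<open>f \<in> c\<close> by auto
  moreover have "based_homotopy_rel k Y y `` ((\<lambda>f. \<phi> \<circ> f) ` c) = (\<Union>h\<in>c. based_homotopy_rel k Y y `` {\<phi> \<circ> h})"
    by blast
  ultimately show ?thesis
    unfolding homotopy_group_induced_def homotopy_group_trivial_def by simp
qed

theorem corollary7p4:
  fixes n :: nat
  assumes "locally_compact_space (euclidean :: 'g::{topological_ab_group_add, t2_space} topology)"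
    and "\<exists>K :: 'g set. compact K \<and> group_closure K = UNIV"
  shows "Sigma_top n = (Hom_TopGr :: ('g \<Rightarrow> real) set)"
proof (intro equalityI subsetI)
  fix \<xi> :: "'g \<Rightarrow> real"
  assume "\<xi> \<in> Sigma_top n"
  then show "\<xi> \<in> Hom_TopGr" by (simp add: Sigma_top_def)
next
  fix \<xi> :: "'g \<Rightarrow> real"
  assume \<xi>: "\<xi> \<in> Hom_TopGr"
  obtain K :: "'g set" where K: "compact K" "group_closure K = UNIV" using assms(2) by blast
  obtain U L :: "'g set" where U: "open U" "0 \<in> U" "U \<subseteq> L" "compact L"
    using assms(1) unfolding locally_compact_space_def by simp blast
  obtain F :: "'g set" and B c where F: "finite F" "compact B"
    "\<And>g. g - (\<Sum>f\<in>F. zmul (c g f) f) \<in> B"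
    "\<And>C. compact C \<Longrightarrow> \<exists>b. \<forall>g h. g - h \<in> C \<longrightarrow> (\<forall>f\<in>F. \<bar>c g f - c h f\<bar> \<le> b)"
    by (rule coarse_coordinates[OF U K]) blast
  have hom: "\<xi> (g + h) = \<xi> g + \<xi> h" for g h using \<xi> by (simp add: Hom_TopGr_def)
  let ?X = "translates_E (halfspace \<xi>)"
  have "essentially_connected (int n - 1) (E_sset UNIV) {C. compact C} ?X"
    unfolding essentially_connected_def
  proof (intro ballI allI impI)
    fix x :: "'g list" and k :: nat and C :: "'g set"
    assume "C \<in> {C. compact C}" and x: "x \<in> simplices (?X C) 0"
    then have C: "compact C" by simp
    obtain D where D: "compact D" "C \<subseteq> D"
      and contr: "\<And>V. finite V \<Longrightarrow> \<exists>q y. (homotopy_step \<xi> C D)\<^sup>*\<^sup>* id q \<and> (\<forall>v\<in>V. q v = y)"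
      using halfspace_contraction[OF hom F C] by blast
    have id: "\<And>n xs. xs \<in> simplices (?X C) n \<Longrightarrow> map id xs \<in> simplices (?X D) n"
      by (rule homotopy_steps_simplices[OF rtranclp.rtrancl_refl D(2)])
    \<comment> \<open>The inclusion is the vertex map of \<open>id\<close>, hence well-defined on
      classes; this identifies the image of the base point.\<close>
    have incl: "realization_incl (?X D) (vertex_point (?X C) x) = vertex_point (?X D) x"
      using vertex_map_class[OF id] by (simp add: vertex_point_def vertex_map_id)
    have "(realization_incl (?X D) \<circ> f, \<lambda>_. vertex_point (?X D) x)
        \<in> based_homotopy_rel k (realization (?X D)) (vertex_point (?X D) x)"
      if f: "f \<in> based_maps k (realization (?X C)) (vertex_point (?X C) x)" for f
    proof -
      have "continuous_map (nsphere k) (realization (?X C)) f" and fb: "f sphere_basepoint = vertex_point (?X C) x"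
        using f by (auto simp: based_maps_def)
      then obtain c where "homotopic_with (\<lambda>_. True) (nsphere k) (realization (?X D))
          (realization_incl (?X D) \<circ> f) (\<lambda>_. c)"
        using sphere_map_null_homotopic[OF D(2) contr] by blast
      from nullhomotopic_sphere_based[OF this] show ?thesis
        by (simp add: based_homotopy_rel_def fb incl)
    qed
    from homotopy_group_induced_trivial[OF this]
    show "\<exists>D\<in>{C. compact C}. C \<le> D \<and>
        (\<forall>c\<in>homotopy_group k (realization (?X C)) (vertex_point (?X C) x).
          homotopy_group_induced k (realization (?X D)) (vertex_point (?X D) x) (realization_incl (?X D)) c =
          homotopy_group_trivial k (realization (?X D)) (vertex_point (?X D) x))"
      using D by blast
  qed
  then show "\<xi> \<in> Sigma_top n" using \<xi> by (simp add: Sigma_top_def)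
qed

end
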